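(* Let $\zeta=e^{2\pi i/3}$, $J=\begin{pmatrix}0&0&1\\0&1&0\\1&0&0\end{pmatrix}$, $\Gamma(1)=\{g\in\mathrm{SL}_3(\mathbb{Z}[\zeta]) : \bar g^tJg=J\}$, $\Gamma(\sqrt{-3})=\{g\in\Gamma(1): g\equiv I_3\bmod\sqrt{-3}\}$ and $\Upsilon=\{(g_{i,j})\in\Gamma(\sqrt{-3}) : g_{1,1}\equiv 1\bmod 3\}$. Then both $\Upsilon$ and $\Gamma(\sqrt{-3})$ have weight denominator $1$. Consequently every multiplier system on $\Gamma(\sqrt{-3})$ (or on $\Upsilon$) has integral weight.
   Context: $\mathrm{SU}(2,1)=\{g\in\mathrm{SL}_3(\mathbb{C}):\bar g^tJg=J\}$. Its universal cover $\widetilde{\mathrm{SU}(2,1)}$ is a central extension by $\mathbb{Z}$; let $z$ generate the kernel. For an arithmetic subgroup $\Gamma$ with pre-image $\tilde\Gamma$, the weight denominator of $\Gamma$ is the order of the image of $z$ in $\tilde\Gamma/[\tilde\Gamma,\tilde\Gamma]$. With $\mathcal{H}=\{\tau\in\mathbb{C}^2:2\mathrm{Re}\tau_1+|\tau_2|^2<0\}$, $g*\tau=(C\tau+D)^{-1}(A\tau+B)$ and $j(g,\tau)=C\tau+D$ for $g=\begin{pmatrix}A&B\\ C&D\end{pmatrix}$ ($A$ a $2\times2$ block, $D$ scalar), a multiplier system of weight $\frac ab$ ($b>0$) on $\Gamma$ is a map $\ell:\Gamma\times\mathcal H\to\mathbb{C}^\times$ with $\ell(gh,\tau)=\ell(g,h*\tau)\ell(h,\tau)$,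 $\ell(g,\tau)^b=\chi(g)j(g,\tau)^a$ for some function $\chi:\Gamma\to\mathbb{C}^\times$, and $\tau\mapsto\ell(g,\tau)$ continuous. *)

theory Defs
  imports "HOL-Analysis.Analysis" "HOL-Algebra.Generated_Groups" "HOL-Algebra.Multiplicative_Group"
begin

definition J_form :: "complex^3^3" where
  "J_form = vector [vector [0, 0, 1], vector [0, 1, 0], vector [1, 0, 0]]"

definition conj_transpose :: "complex^'n^'m \<Rightarrow> complex^'m^'n" where
  "conj_transpose g = transpose (\<chi> i j. cnj (g $ i $ j))"

definition SU21 :: "(complex^3^3) set" where
  "SU21 = {g. det g = 1 \<and> conj_transpose g ** J_form ** g = J_form}"

definition SU21_group :: "(complex^3^3) monoid" where
  "SU21_group = \<lparr>carrier = SU21, mult = (**), one = mat 1\<rparr>"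

text \<open>
  The universal cover is modelled as the set of homotopy classes, with fixed endpoints, of paths
  in \<open>SU(2,1)\<close> that start at the identity. The group law is induced by the pointwise
  product of paths, and the covering map sends a class to the common endpoint of its members.
  Only the abstract group underlying the cover is needed, so its topology is not introduced.
\<close>

definition path_class :: "(real \<Rightarrow> complex^3^3) \<Rightarrow> (real \<Rightarrow> complex^3^3) set" where
  "path_class p = {q. homotopic_paths SU21 p q}"

definition SU21_cover :: "(real \<Rightarrow> complex^3^3) set monoid" where
  "SU21_cover =
    \<lparr>carrier = {path_class p | p. path p \<and> path_image p \<subseteq> SU21 \<and> pathstart p = mat 1},
     mult = (\<lambda>X Y. \<Union>p\<in>X. \<Union>q\<in>Y. path_class (\<lambda>t. p t ** q t)),
     one = path_class (\<lambda>t. mat 1)\<rparr>"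

definition cover_proj :: "(real \<Rightarrow> complex^3^3) set \<Rightarrow> complex^3^3" where
  "cover_proj X = the_elem (pathfinish ` X)"

definition cover_preimage :: "(complex^3^3) set \<Rightarrow> (real \<Rightarrow> complex^3^3) set set" where
  "cover_preimage \<Gamma> = {X \<in> carrier SU21_cover. cover_proj X \<in> \<Gamma>}"

definition generates_cover_kernel :: "(real \<Rightarrow> complex^3^3) set \<Rightarrow> bool" where
  "generates_cover_kernel z \<longleftrightarrow>
     z \<in> kernel SU21_cover SU21_group cover_proj \<and>
     generate SU21_cover {z} = kernel SU21_cover SU21_group cover_proj"

text \<open>
  The order of the image of \<open>z\<close> in the abelianization of the preimage of \<open>\<Gamma>\<close>. It is
  intended for \<open>z\<close> a generator of the kernel; such a generator is unique up to inversion, so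
  the value does not depend on the choice. By the convention of \<open>group.ord\<close>, infinite order
  would give \<open>0\<close>.
\<close>

definition weight_denominator ::
    "(real \<Rightarrow> complex^3^3) set \<Rightarrow> (complex^3^3) set \<Rightarrow> nat" where
  "weight_denominator z \<Gamma> =
    (let G = SU21_cover\<lparr>carrier := cover_preimage \<Gamma>\<rparr>;
         D = derived G (carrier G)
     in group.ord (G Mod D) (D #>\<^bsub>G\<^esub> z))"

definition siegel_domain :: "(complex^2) set" where
  "siegel_domain = {\<tau>. 2 * Re (\<tau> $ 1) + (cmod (\<tau> $ 2))\<^sup>2 < 0}"

definition j_factor :: "complex^3^3 \<Rightarrow> complex^2 \<Rightarrow> complex" where
  "j_factor g \<tau> = g $ 3 $ 1 * \<tau> $ 1 + g $ 3 $ 2 * \<tau> $ 2 + g $ 3 $ 3"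

definition siegel_act :: "complex^3^3 \<Rightarrow> complex^2 \<Rightarrow> complex^2" where
  "siegel_act g \<tau> = inverse (j_factor g \<tau>) *s
     vector [g $ 1 $ 1 * \<tau> $ 1 + g $ 1 $ 2 * \<tau> $ 2 + g $ 1 $ 3,
             g $ 2 $ 1 * \<tau> $ 1 + g $ 2 $ 2 * \<tau> $ 2 + g $ 2 $ 3]"

text \<open>
  \<open>l\<close> is a multiplier system on \<open>\<Gamma>\<close> of weight \<open>a / b\<close>, where the fraction need not be in
  lowest terms; only the values of \<open>l\<close> on \<open>\<Gamma> \<times> siegel_domain\<close> matter.
\<close>

definition multiplier_system ::
    "(complex^3^3) set \<Rightarrow> int \<Rightarrow> nat \<Rightarrow> (complex^3^3 \<Rightarrow> complex^2 \<Rightarrow> complex) \<Rightarrow> bool" where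
  "multiplier_system \<Gamma> a b l \<longleftrightarrow>
     b > 0 \<and>
     (\<forall>g\<in>\<Gamma>. \<forall>\<tau>\<in>siegel_domain. l g \<tau> \<noteq> 0) \<and>
     (\<forall>g\<in>\<Gamma>. \<forall>h\<in>\<Gamma>. \<forall>\<tau>\<in>siegel_domain.
        l (g ** h) \<tau> = l g (siegel_act h \<tau>) * l h \<tau>) \<and>
     (\<exists>u. (\<forall>g\<in>\<Gamma>. u g \<noteq> 0) \<and>
        (\<forall>g\<in>\<Gamma>. \<forall>\<tau>\<in>siegel_domain. l g \<tau> ^ b = u g * j_factor g \<tau> powi a)) \<and>
     (\<forall>g\<in>\<Gamma>. continuous_on siegel_domain (l g))"

definition zeta3 :: complex where
  "zeta3 = exp (2 * of_real pi * \<i> / 3)"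

text \<open>\<open>zeta3\<close> is a root of \<open>X\<^sup>2 + X + 1\<close>, so \<open>1, zeta3\<close> is an integral basis of the ring it generates.\<close>

definition Eisenstein_ints :: "complex set" where
  "Eisenstein_ints = {of_int m + of_int n * zeta3 | m n. True}"

definition sqrt_minus_3 :: complex where
  "sqrt_minus_3 = \<i> * of_real (sqrt 3)"

definition eis_cong :: "complex \<Rightarrow> complex \<Rightarrow> complex \<Rightarrow> bool" where
  "eis_cong m x y \<longleftrightarrow> (\<exists>c\<in>Eisenstein_ints. x - y = m * c)"

definition Gamma_1 :: "(complex^3^3) set" where
  "Gamma_1 = {g \<in> SU21. \<forall>i j. g $ i $ j \<in> Eisenstein_ints}"

definition Gamma_sqrt_minus_3 :: "(complex^3^3) set" where
  "Gamma_sqrt_minus_3 =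
     {g \<in> Gamma_1. \<forall>i j. eis_cong sqrt_minus_3 (g $ i $ j) (mat 1 $ i $ j)}"

definition Upsilon :: "(complex^3^3) set" where
  "Upsilon = {g \<in> Gamma_sqrt_minus_3. eis_cong 3 (g $ 1 $ 1) 1}"

end

theory Submission
  imports Defs
begin

text \<open>
  The preimage of a subgroup in the universal cover is described by pairs of an element \<open>g\<close> and a
  continuous branch of \<open>log j(g, \<tau>)\<close>; the central \<open>z\<close> becomes \<open>2\<pi>i\<close> over the identity. Let \<open>S\<close> be the
  Heisenberg-central translation by \<open>-\<surd>-3\<close> and \<open>n\<close> its conjugate by \<open>-J\<close>, both in \<open>\<Upsilon>\<close> and both with
  a distinguished lift. In the block of rows and columns 1 and 3 the product \<open>n S\<close> is an elliptic
  element of order 3 with fixed point \<open>(\<zeta>, 0)\<close>, around which it rotates so that its lift satisfies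
  \<open>(n S)\<^sup>3 = z\<close>. On the other hand \<open>S\<^sup>3\<close> is a commutator of Heisenberg elements of \<open>\<Upsilon>\<close>, hence so is
  \<open>n\<^sup>3\<close>, and modulo commutators \<open>z = (n S)\<^sup>3 = n\<^sup>3 S\<^sup>3 = 1\<close>. For the path model it suffices that the
  elements involved are joined to the identity by explicit paths, and that a loop whose branch
  winds once must be the generator of the kernel or its inverse. A multiplier system of weight
  \<open>a/b\<close> yields a character of the lift of the group with value \<open>exp(-2\<pi>i a/b)\<close> on \<open>z\<close>, so \<open>a/b\<close> is an
  integer.
\<close>

subsection \<open>The action on the Siegel domain\<close>

lemmas mat3_simps = vec_eq_iff forall_3 matrix_matrix_mult_def sum_3 mat_def vector_3

lemma conj_transpose_nth [simp]: "conj_transpose g $ i $ j = cnj (g $ j $ i)"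
  by (simp add: conj_transpose_def transpose_def)

lemma conj_transpose_mult:
  "conj_transpose ((g::complex^3^3) ** h) = conj_transpose h ** conj_transpose g"
  by (simp add: mat3_simps mult.commute)

lemma conj_transpose_one: "conj_transpose (mat 1 :: complex^3^3) = mat 1"
  by (simp add: mat3_simps)

lemma J_form_squared: "J_form ** J_form = mat 1"
  by (simp add: mat3_simps J_form_def)

text \<open>Multiplying the defining relation by the involution \<open>J_form\<close> exhibits this
  as the inverse of \<open>g\<close>. The closed formula makes continuity and integrality of the
  inverse visible entry by entry.\<close>

definition SU21_inverse :: "complex^3^3 \<Rightarrow> complex^3^3" where
  "SU21_inverse g = J_form ** conj_transpose g ** J_form"

lemma SU21_inverse_nth:
  "SU21_inverse g = vector [vector [cnj (g$3$3), cnj (g$2$3), cnj (g$1$3)],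
                            vector [cnj (g$3$2), cnj (g$2$2), cnj (g$1$2)],
                            vector [cnj (g$3$1), cnj (g$2$1), cnj (g$1$1)]]"
  by (simp add: SU21_inverse_def mat3_simps J_form_def)

lemma SU21_left_inverse: "g \<in> SU21 \<Longrightarrow> SU21_inverse g ** g = mat 1"
  by (simp add: SU21_inverse_def SU21_def J_form_squared flip: matrix_mul_assoc)

lemma SU21_right_inverse: "g \<in> SU21 \<Longrightarrow> g ** SU21_inverse g = mat 1"
  using SU21_left_inverse matrix_left_right_inverse by blast

lemma SU21_one: "mat 1 \<in> SU21"
  by (simp add: SU21_def conj_transpose_one)

lemma SU21_mult: "g \<in> SU21 \<Longrightarrow> h \<in> SU21 \<Longrightarrow> g ** h \<in> SU21"
  unfolding SU21_def mem_Collect_eq det_mul conj_transpose_mult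
  by (metis matrix_mul_assoc mult_1)

lemma SU21_inverse_closed:
  assumes "g \<in> SU21" shows "SU21_inverse g \<in> SU21"
proof -
  let ?h = "SU21_inverse g"
  have gh: "g ** ?h = mat 1"
    by (rule SU21_right_inverse[OF assms])
  then have "det g * det ?h = 1"
    by (metis det_I det_mul)
  then have "det ?h = 1"
    using assms by (simp add: SU21_def)
  moreover have "conj_transpose ?h ** J_form ** ?h
      = conj_transpose ?h ** (conj_transpose g ** J_form ** g) ** ?h"
    using assms by (simp add: SU21_def)
  then have "conj_transpose ?h ** J_form ** ?h = conj_transpose (g ** ?h) ** J_form ** (g ** ?h)"
    by (simp add: conj_transpose_mult matrix_mul_assoc)
  then have "conj_transpose ?h ** J_form ** ?h = J_form"
    by (simp add: gh conj_transpose_one)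
  ultimately show ?thesis
    by (simp add: SU21_def)
qed

lemma group_SU21: "group SU21_group"
proof (rule groupI)
  show "\<exists>y\<in>carrier SU21_group. y \<otimes>\<^bsub>SU21_group\<^esub> x = \<one>\<^bsub>SU21_group\<^esub>"
    if "x \<in> carrier SU21_group" for x
    using that SU21_inverse_closed[of x] SU21_left_inverse[of x] by (auto simp: SU21_group_def)
qed (auto simp: SU21_group_def SU21_mult SU21_one matrix_mul_assoc)

lemma inv_SU21_group: "g \<in> SU21 \<Longrightarrow> inv\<^bsub>SU21_group\<^esub> g = SU21_inverse g"
  by (rule group.inv_equality[OF group_SU21])
    (auto simp: SU21_group_def SU21_left_inverse SU21_inverse_closed)

section \<open>The Hermitian form and the automorphy factor\<close>

definition herm_form :: "complex^3 \<Rightarrow> complex" where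
  "herm_form x = cnj (x $ 1) * x $ 3 + cnj (x $ 2) * x $ 2 + cnj (x $ 3) * x $ 1"

lemma herm_form_eq: "herm_form x = (\<Sum>i\<in>UNIV. cnj (x $ i) * (J_form *v x) $ i)"
  by (simp add: herm_form_def matrix_vector_mult_def sum_3 J_form_def)

lemma sum_cnj_matrix_vector_mult:
  "(\<Sum>i\<in>UNIV. cnj (((g::complex^3^3) *v x) $ i) * y $ i)
    = (\<Sum>i\<in>UNIV. cnj (x $ i) * (conj_transpose g *v y) $ i)"
  by (simp add: matrix_vector_mult_def sum_3 algebra_simps)

lemma herm_form_SU21:
  assumes "g \<in> SU21" shows "herm_form (g *v x) = herm_form x"
proof -
  have "herm_form (g *v x) = (\<Sum>i\<in>UNIV. cnj (x $ i) * (conj_transpose g *v (J_form *v (g *v x))) $ i)"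
    by (simp only: herm_form_eq sum_cnj_matrix_vector_mult)
  also have "conj_transpose g *v (J_form *v (g *v x)) = J_form *v x"
    using assms by (simp add: SU21_def matrix_vector_mul_assoc matrix_mul_assoc)
  finally show ?thesis
    by (simp add: herm_form_eq)
qed

text \<open>The domain is viewed in the projective plane as the set of negative lines of
  \<open>herm_form\<close>; this picks the representative with last coordinate 1.\<close>

definition homog :: "complex^2 \<Rightarrow> complex^3" where
  "homog \<tau> = vector [\<tau> $ 1, \<tau> $ 2, 1]"

lemma homog_nth [simp]: "homog \<tau> $ 1 = \<tau> $ 1" "homog \<tau> $ 2 = \<tau> $ 2" "homog \<tau> $ 3 = 1"
  by (simp_all add: homog_def)

lemma homog_inject: "homog \<sigma> = homog \<tau> \<longleftrightarrow> \<sigma> = \<tau>"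
  by (auto simp: vec_eq_iff forall_2 forall_3)

lemma herm_form_homog: "herm_form (homog \<tau>) = of_real (2 * Re (\<tau> $ 1) + (cmod (\<tau> $ 2))\<^sup>2)"
  by (simp add: herm_form_def complex_eq_iff cmod_power2) (simp add: power2_eq_square)

lemma siegel_domain_iff: "\<tau> \<in> siegel_domain \<longleftrightarrow> Re (herm_form (homog \<tau>)) < 0"
  by (simp add: siegel_domain_def herm_form_homog)

lemma j_factor_eq: "j_factor g \<tau> = (g *v homog \<tau>) $ 3"
  by (simp add: j_factor_def matrix_vector_mult_def sum_3)

text \<open>If the last coordinate of the image vector vanished, the form would reduce to the
  squared modulus of the middle one, while invariance keeps it negative.\<close>

lemma j_factor_nonzero:
  assumes "g \<in> SU21" "\<tau> \<in> siegel_domain" shows "j_factor g \<tau> \<noteq> 0"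
proof
  assume "j_factor g \<tau> = 0"
  then have "herm_form (g *v homog \<tau>) = of_real ((cmod ((g *v homog \<tau>) $ 2))\<^sup>2)"
    by (simp add: herm_form_def j_factor_eq complex_eq_iff cmod_power2) (simp add: power2_eq_square)
  then have "Re (herm_form (homog \<tau>)) \<ge> 0"
    using herm_form_SU21[OF assms(1), of "homog \<tau>"] by simp
  with assms(2) show False
    by (simp add: siegel_domain_iff)
qed

lemma mult_homog:
  assumes "g \<in> SU21" "\<tau> \<in> siegel_domain"
  shows "g *v homog \<tau> = j_factor g \<tau> *s homog (siegel_act g \<tau>)"
  using j_factor_nonzero[OF assms]
  by (simp add: vec_eq_iff forall_3 siegel_act_def j_factor_eq matrix_vector_mult_def sum_3
      vector_scalar_mult_def)

lemma herm_form_scale: "herm_form (c *s x) = of_real ((cmod c)\<^sup>2) * herm_form x"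
  by (simp add: herm_form_def complex_norm_square algebra_simps del: of_real_power)

lemma siegel_act_closed:
  assumes "g \<in> SU21" "\<tau> \<in> siegel_domain" shows "siegel_act g \<tau> \<in> siegel_domain"
proof -
  have "herm_form (homog \<tau>) = of_real ((cmod (j_factor g \<tau>))\<^sup>2) * herm_form (homog (siegel_act g \<tau>))"
    using herm_form_SU21[OF assms(1), of "homog \<tau>"] mult_homog[OF assms]
    by (simp only: herm_form_scale)
  then have "Re (herm_form (homog \<tau>)) = (cmod (j_factor g \<tau>))\<^sup>2 * Re (herm_form (homog (siegel_act g \<tau>)))"
    by simp
  with assms(2) show ?thesis
    by (auto simp: siegel_domain_iff mult_less_0_iff)
qed

text \<open>Both the cocycle rule for \<open>j_factor\<close> and the composition law for
  \<open>siegel_act\<close> are read off from this one identity.\<close>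

lemma mult_homog_mult:
  assumes "g \<in> SU21" "h \<in> SU21" "\<tau> \<in> siegel_domain"
  shows "(g ** h) *v homog \<tau>
    = (j_factor g (siegel_act h \<tau>) * j_factor h \<tau>) *s homog (siegel_act g (siegel_act h \<tau>))"
proof -
  have "(g ** h) *v homog \<tau> = g *v (j_factor h \<tau> *s homog (siegel_act h \<tau>))"
    by (simp add: mult_homog[OF assms(2,3)] flip: matrix_vector_mul_assoc)
  also have "\<dots> = j_factor h \<tau> *s (g *v homog (siegel_act h \<tau>))"
    by (simp add: vector_scalar_commute)
  finally show ?thesis
    by (simp add: mult_homog[OF assms(1) siegel_act_closed[OF assms(2,3)]] vector_scalar_mult_def
        vec_eq_iff mult_ac)
qed

lemma j_factor_mult:
  assumes "g \<in> SU21" "h \<in> SU21" "\<tau> \<in> siegel_domain"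
  shows "j_factor (g ** h) \<tau> = j_factor g (siegel_act h \<tau>) * j_factor h \<tau>"
  unfolding j_factor_eq[of "g ** h"] mult_homog_mult[OF assms] by simp

lemma siegel_act_mult:
  assumes "g \<in> SU21" "h \<in> SU21" "\<tau> \<in> siegel_domain"
  shows "siegel_act (g ** h) \<tau> = siegel_act g (siegel_act h \<tau>)"
proof -
  let ?j = "j_factor (g ** h) \<tau>"
  have "?j *s homog (siegel_act (g ** h) \<tau>) = ?j *s homog (siegel_act g (siegel_act h \<tau>))"
    using mult_homog_mult[OF assms] mult_homog[OF SU21_mult[OF assms(1,2)] assms(3)]
    by (simp add: j_factor_mult[OF assms])
  then show ?thesis
    using j_factor_nonzero[OF SU21_mult[OF assms(1,2)] assms(3)]
    by (simp add: vector_mul_lcancel homog_inject)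
qed

lemma j_factor_one [simp]: "j_factor (mat 1) \<tau> = 1"
  by (simp add: j_factor_def mat_def)

lemma siegel_act_one [simp]: "siegel_act (mat 1) \<tau> = \<tau>"
  by (simp add: siegel_act_def vec_eq_iff forall_2) (simp add: mat_def)

lemma siegel_act_inverse:
  assumes "g \<in> SU21" "\<tau> \<in> siegel_domain"
  shows "siegel_act g (siegel_act (SU21_inverse g) \<tau>) = \<tau>"
    "siegel_act (SU21_inverse g) (siegel_act g \<tau>) = \<tau>"
  using assms siegel_act_mult[of g "SU21_inverse g" \<tau>] siegel_act_mult[of "SU21_inverse g" g \<tau>]
  by (simp_all add: SU21_right_inverse SU21_left_inverse SU21_inverse_closed)

lemma continuous_on_j_factor [continuous_intros]:
  assumes "continuous_on S g" "continuous_on S f"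
  shows "continuous_on S (\<lambda>x. j_factor (g x) (f x))"
proof -
  have g: "continuous_on S (\<lambda>x. g x $ i $ j)" for i j
    by (intro continuous_intros assms)
  have f: "continuous_on S (\<lambda>x. f x $ i)" for i
    by (intro continuous_intros assms)
  show ?thesis
    unfolding j_factor_def by (intro continuous_intros g f)
qed

lemma siegel_act_nth:
  "siegel_act g \<tau> $ 1 = inverse (j_factor g \<tau>) * (g $ 1 $ 1 * \<tau> $ 1 + g $ 1 $ 2 * \<tau> $ 2 + g $ 1 $ 3)"
  "siegel_act g \<tau> $ 2 = inverse (j_factor g \<tau>) * (g $ 2 $ 1 * \<tau> $ 1 + g $ 2 $ 2 * \<tau> $ 2 + g $ 2 $ 3)"
  by (simp_all add: siegel_act_def)

lemma continuous_on_siegel_act [continuous_intros]: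
  assumes "continuous_on S g" "continuous_on S f" "\<And>x. x \<in> S \<Longrightarrow> g x \<in> SU21"
    "\<And>x. x \<in> S \<Longrightarrow> f x \<in> siegel_domain"
  shows "continuous_on S (\<lambda>x. siegel_act (g x) (f x))"
proof -
  have nz: "\<forall>x\<in>S. j_factor (g x) (f x) \<noteq> 0"
    by (simp add: assms j_factor_nonzero)
  have "continuous_on S (\<lambda>x. siegel_act (g x) (f x) $ i)" for i
    using exhaust_2[of i]
    by (elim disjE; simp only: siegel_act_nth) (intro continuous_intros assms nz)+
  then have "continuous_on S (\<lambda>x. \<chi> i. siegel_act (g x) (f x) $ i)"
    by (intro continuous_on_vec_lambda)
  then show ?thesis
    by simp
qed

text \<open>The first coordinate enters linearly and the squared modulus is convex. Convexity yields
  both the existence of logarithm branches, by contractibility, and their uniqueness, by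
  connectedness.\<close>

lemma convex_siegel_domain: "convex siegel_domain"
proof (rule convexI)
  fix x y :: "complex^2" and u v :: real
  assume x: "x \<in> siegel_domain" and y: "y \<in> siegel_domain" and uv: "0 \<le> u" "0 \<le> v" "u + v = 1"
  let ?a = "cmod (x $ 2)" and ?b = "cmod (y $ 2)"
  have "cmod (u *\<^sub>R (x $ 2) + v *\<^sub>R (y $ 2)) \<le> u * ?a + v * ?b"
    using uv by (metis abs_of_nonneg norm_scaleR norm_triangle_ineq)
  then have "(cmod (u *\<^sub>R (x $ 2) + v *\<^sub>R (y $ 2)))\<^sup>2 \<le> (u * ?a + v * ?b)\<^sup>2"
    by (rule power_mono) simp
  also have "\<dots> = u * ?a\<^sup>2 + v * ?b\<^sup>2 - u * v * (?a - ?b)\<^sup>2"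
  proof -
    have v: "v = 1 - u" using uv by simp
    show ?thesis unfolding v by (simp add: power2_eq_square algebra_simps)
  qed
  also have "\<dots> \<le> u * ?a\<^sup>2 + v * ?b\<^sup>2"
    using uv by simp
  finally have "2 * Re ((u *\<^sub>R x + v *\<^sub>R y) $ 1) + (cmod ((u *\<^sub>R x + v *\<^sub>R y) $ 2))\<^sup>2
      \<le> u * (2 * Re (x $ 1) + ?a\<^sup>2) + v * (2 * Re (y $ 1) + ?b\<^sup>2)"
    by (simp add: algebra_simps)
  also have "\<dots> < 0"
    using x y uv by (auto simp: siegel_domain_def)
      (smt (verit) mult_less_0_iff mult_nonneg_nonpos)
  finally show "u *\<^sub>R x + v *\<^sub>R y \<in> siegel_domain"
    by (simp add: siegel_domain_def)
qed

lemma siegel_domain_nonempty: "vector [-1, 0] \<in> siegel_domain"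
  by (simp add: siegel_domain_def)

subsection \<open>Branches of the logarithm of the automorphy factor\<close>

lemma continuous_on_matrix_mult [continuous_intros]:
  fixes f :: "'a::topological_space \<Rightarrow> complex^'n^'m" and g :: "'a \<Rightarrow> complex^'k^'n"
  assumes "continuous_on S f" "continuous_on S g"
  shows "continuous_on S (\<lambda>x. f x ** g x)"
proof -
  have "continuous_on S (\<lambda>x. f x $ i $ j)" "continuous_on S (\<lambda>x. g x $ j $ l)" for i j l
    by (intro continuous_intros assms)+
  then show ?thesis
    unfolding matrix_matrix_mult_def
    by (intro continuous_on_vec_lambda continuous_on_sum continuous_on_mult)
qed

lemma continuous_on_SU21_inverse [continuous_intros]:
  assumes "continuous_on S f"
  shows "continuous_on S (\<lambda>x. SU21_inverse (f x))"
proof -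
  have "continuous_on S (\<lambda>x. f x $ i $ j)" for i j
    by (intro continuous_intros assms)
  then have "continuous_on S (\<lambda>x. conj_transpose (f x))"
    unfolding conj_transpose_def transpose_def
    by (intro continuous_on_vec_lambda) (simp add: continuous_on_cnj)
  then show ?thesis
    unfolding SU21_inverse_def by (intro continuous_intros)
qed

text \<open>The difference of two logarithms, divided by 2 pi i, is continuous and integer valued,
  so it is constant on a connected set; agreement at one point makes it zero.\<close>

lemma complex_log_unique:
  fixes f g :: "'a::topological_space \<Rightarrow> complex"
  assumes "connected S" "continuous_on S f" "continuous_on S g"
    and "\<And>y. y \<in> S \<Longrightarrow> exp (f y) = exp (g y)"
    and "a \<in> S" "f a = g a" "x \<in> S"
  shows "f x = g x"
proof -
  let ?d = "\<lambda>x. (f x - g x) / (2 * of_real pi * \<i>)"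
  have d: "?d x \<in> \<int>" if x: "x \<in> S" for x
  proof -
    obtain n :: int where "f x = g x + (of_int (2 * n) * pi) * \<i>"
      using assms(4)[OF x] unfolding exp_eq by blast
    then have "?d x = of_int n"
      by simp
    then show ?thesis
      by simp
  qed
  have "?d constant_on S"
  proof (rule continuous_discrete_range_constant[OF assms(1)])
    show "continuous_on S ?d"
      by (intro continuous_intros assms) simp
    show "\<exists>e>0. \<forall>y. y \<in> S \<and> ?d y \<noteq> ?d x \<longrightarrow> e \<le> cmod (?d y - ?d x)" if "x \<in> S" for x
    proof (intro exI[of _ 1] conjI allI impI)
      fix y assume y: "y \<in> S \<and> ?d y \<noteq> ?d x"
      then have "?d y - ?d x \<in> \<int>"
        using d that by (blast intro: Ints_diff)
      then obtain n where n: "?d y - ?d x = of_int n"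
        by (rule Ints_cases)
      then have "n \<noteq> 0"
        using y by auto
      then show "1 \<le> cmod (?d y - ?d x)"
        unfolding n norm_of_int by linarith
    qed simp
  qed
  then have "?d x = ?d a"
    using assms(5,7) unfolding constant_on_def by metis
  then show ?thesis
    using assms(6) by simp
qed

text \<open>
  A concrete model of the universal cover: elements paired with a branch of the logarithm of their
  automorphy factor. The branch is set to \<open>0\<close> off the Siegel domain, so that pairs are equal iff
  the branches agree on the domain.
\<close>

definition lift_group :: "((complex^3^3) \<times> (complex^2 \<Rightarrow> complex)) monoid" where
  "lift_group =
    \<lparr>carrier = {(g, L). g \<in> SU21 \<and> continuous_on siegel_domain L \<and>
        (\<forall>\<tau>\<in>siegel_domain. exp (L \<tau>) = j_factor g \<tau>) \<and> (\<forall>\<tau>. \<tau> \<notin> siegel_domain \<longrightarrow> L \<tau> = 0)},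
     mult = (\<lambda>(g, L) (h, M). (g ** h, \<lambda>\<tau>. if \<tau> \<in> siegel_domain then L (siegel_act h \<tau>) + M \<tau> else 0)),
     one = (mat 1, \<lambda>_. 0)\<rparr>"

lemma lift_group_carrier:
  "(g, L) \<in> carrier lift_group \<longleftrightarrow> g \<in> SU21 \<and> continuous_on siegel_domain L \<and>
    (\<forall>\<tau>\<in>siegel_domain. exp (L \<tau>) = j_factor g \<tau>) \<and> (\<forall>\<tau>. \<tau> \<notin> siegel_domain \<longrightarrow> L \<tau> = 0)"
  by (simp add: lift_group_def)

lemma lift_group_mult:
  "(g, L) \<otimes>\<^bsub>lift_group\<^esub> (h, M)
    = (g ** h, \<lambda>\<tau>. if \<tau> \<in> siegel_domain then L (siegel_act h \<tau>) + M \<tau> else 0)"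
  by (simp add: lift_group_def)

lemma lift_group_one: "\<one>\<^bsub>lift_group\<^esub> = (mat 1, \<lambda>_. 0)"
  by (simp add: lift_group_def)

lemma fst_lift_group_mult [simp]: "fst (x \<otimes>\<^bsub>lift_group\<^esub> y) = fst x ** fst y"
  by (cases x; cases y) (simp add: lift_group_mult)

lemma snd_lift_group_mult:
  "\<tau> \<in> siegel_domain \<Longrightarrow> snd (x \<otimes>\<^bsub>lift_group\<^esub> y) \<tau> = snd x (siegel_act (fst y) \<tau>) + snd y \<tau>"
  by (cases x; cases y) (simp add: lift_group_mult)

lemma continuous_on_compose_siegel_act:
  assumes "continuous_on siegel_domain L" "g \<in> SU21"
  shows "continuous_on siegel_domain (\<lambda>\<tau>. L (siegel_act g \<tau>))"
  using assms by (auto intro!: continuous_on_compose2[OF assms(1)] continuous_intros siegel_act_closed)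

lemma lift_group_mult_closed:
  assumes "x \<in> carrier lift_group" "y \<in> carrier lift_group"
  shows "x \<otimes>\<^bsub>lift_group\<^esub> y \<in> carrier lift_group"
proof -
  obtain g L h M where eq: "x = (g, L)" "y = (h, M)"
    by (metis surj_pair)
  have "continuous_on siegel_domain (\<lambda>\<tau>. if \<tau> \<in> siegel_domain then L (siegel_act h \<tau>) + M \<tau> else 0)
    \<longleftrightarrow> continuous_on siegel_domain (\<lambda>\<tau>. L (siegel_act h \<tau>) + M \<tau>)"
    by (rule continuous_on_cong) auto
  moreover have "continuous_on siegel_domain (\<lambda>\<tau>. L (siegel_act h \<tau>) + M \<tau>)"
    using assms by (intro continuous_intros continuous_on_compose_siegel_act)
      (auto simp: eq lift_group_carrier)
  ultimately show ?thesis
    using assms by (auto simp: eq lift_group_mult lift_group_carrier SU21_mult exp_add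
        siegel_act_closed j_factor_mult)
qed

lemma group_lift_group: "group lift_group"
proof (rule groupI)
  show "\<one>\<^bsub>lift_group\<^esub> \<in> carrier lift_group"
    by (simp add: lift_group_one lift_group_carrier SU21_one)
  show "x \<otimes>\<^bsub>lift_group\<^esub> y \<in> carrier lift_group"
    if "x \<in> carrier lift_group" "y \<in> carrier lift_group" for x y
    using that by (rule lift_group_mult_closed)
  show "x \<otimes>\<^bsub>lift_group\<^esub> y \<otimes>\<^bsub>lift_group\<^esub> z = x \<otimes>\<^bsub>lift_group\<^esub> (y \<otimes>\<^bsub>lift_group\<^esub> z)"
    if "x \<in> carrier lift_group" "y \<in> carrier lift_group" "z \<in> carrier lift_group" for x y z
    using that by (cases x; cases y; cases z)
      (auto simp: lift_group_mult lift_group_carrier matrix_mul_assoc siegel_act_closed siegel_act_mult)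
  show "\<one>\<^bsub>lift_group\<^esub> \<otimes>\<^bsub>lift_group\<^esub> x = x" if "x \<in> carrier lift_group" for x
    using that by (cases x) (auto simp: lift_group_one lift_group_mult lift_group_carrier)
  show "\<exists>y\<in>carrier lift_group. y \<otimes>\<^bsub>lift_group\<^esub> x = \<one>\<^bsub>lift_group\<^esub>"
    if "x \<in> carrier lift_group" for x
  proof -
    obtain g L where x: "x = (g, L)"
      by (metis surj_pair)
    have g: "g \<in> SU21" and L: "continuous_on siegel_domain L"
      "\<And>\<tau>. \<tau> \<in> siegel_domain \<Longrightarrow> exp (L \<tau>) = j_factor g \<tau>"
      using that by (auto simp: x lift_group_carrier)
    let ?h = "SU21_inverse g"
    \<comment> \<open>A left inverse must satisfy
      \<open>M (siegel_act g \<tau>) + L \<tau> = 0\<close>; replacing the point by its image under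
      the inverse matrix gives this formula.\<close>
    define M where "M \<tau> = (if \<tau> \<in> siegel_domain then - L (siegel_act ?h \<tau>) else 0)" for \<tau>
    have h: "?h \<in> SU21"
      by (rule SU21_inverse_closed[OF g])
    have "continuous_on siegel_domain M \<longleftrightarrow> continuous_on siegel_domain (\<lambda>\<tau>. - L (siegel_act ?h \<tau>))"
      by (rule continuous_on_cong) (auto simp: M_def)
    then have "continuous_on siegel_domain M"
      by (simp add: continuous_on_minus continuous_on_compose_siegel_act L h)
    moreover have "exp (M \<tau>) = j_factor ?h \<tau>" if "\<tau> \<in> siegel_domain" for \<tau>
    proof -
      have "j_factor g (siegel_act ?h \<tau>) * j_factor ?h \<tau> = 1"
        using j_factor_mult[OF g h that] by (simp add: SU21_right_inverse g)
      then show ?thesis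
        using that by (simp add: M_def exp_minus L siegel_act_closed h inverse_unique)
    qed
    ultimately have "(?h, M) \<in> carrier lift_group"
      using h by (simp add: lift_group_carrier M_def)
    moreover have "(?h, M) \<otimes>\<^bsub>lift_group\<^esub> x = \<one>\<^bsub>lift_group\<^esub>"
      by (auto simp: x lift_group_mult lift_group_one SU21_left_inverse g M_def siegel_act_closed
          siegel_act_inverse)
    ultimately show ?thesis
      by blast
  qed
qed

lemma connected_siegel_domain: "connected siegel_domain"
  by (simp add: convex_connected convex_siegel_domain)

text \<open>One value fixes a branch, by uniqueness of logarithms. Identities in
  \<open>lift_group\<close> can thus be checked on matrices and at one convenient point.\<close>

lemma lift_group_eqI:
  assumes "x \<in> carrier lift_group" "y \<in> carrier lift_group" "fst x = fst y"
    "\<tau> \<in> siegel_domain" "snd x \<tau> = snd y \<tau>"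
  shows "x = y"
proof -
  obtain g L h M where eq: "x = (g, L)" "y = (h, M)"
    by (metis surj_pair)
  have "L \<sigma> = M \<sigma>" for \<sigma>
  proof (cases "\<sigma> \<in> siegel_domain")
    case True
    show ?thesis
      by (rule complex_log_unique[OF connected_siegel_domain _ _ _ assms(4) _ True])
        (use assms in \<open>auto simp: eq lift_group_carrier\<close>)
  qed (use assms in \<open>auto simp: eq lift_group_carrier\<close>)
  then show ?thesis
    using assms(3) by (auto simp: eq)
qed

section \<open>Lifts of the identity matrix\<close>

definition deck :: "int \<Rightarrow> (complex^3^3) \<times> (complex^2 \<Rightarrow> complex)" where
  "deck n = (mat 1, \<lambda>\<tau>. if \<tau> \<in> siegel_domain then of_int n * (2 * of_real pi * \<i>) else 0)"

lemma deck_carrier: "deck n \<in> carrier lift_group"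
proof -
  have "continuous_on siegel_domain (\<lambda>\<tau>. if \<tau> \<in> siegel_domain then of_int n * (2 * of_real pi * \<i>) else 0)
    \<longleftrightarrow> continuous_on siegel_domain (\<lambda>\<tau>. of_int n * (2 * complex_of_real pi * \<i>))"
    by (rule continuous_on_cong) auto
  moreover have "exp (of_int n * (2 * complex_of_real pi * \<i>)) = 1"
    by (simp add: exp_eq_1)
  ultimately show ?thesis
    by (simp add: deck_def lift_group_carrier SU21_one)
qed

lemma deck_mult: "deck m \<otimes>\<^bsub>lift_group\<^esub> deck n = deck (m + n)"
  by (auto simp: deck_def lift_group_mult algebra_simps)

lemma deck_0: "deck 0 = \<one>\<^bsub>lift_group\<^esub>"
  by (auto simp: deck_def lift_group_one)

lemma deck_inject: "deck m = deck n \<longleftrightarrow> m = n"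
proof
  assume "deck m = deck n"
  then have "snd (deck m) (vector [-1, 0]) = snd (deck n) (vector [-1, 0])"
    by simp
  then show "m = n"
    using siegel_domain_nonempty by (simp add: deck_def)
qed auto

lemma deck_int_pow: "deck n [^]\<^bsub>lift_group\<^esub> (k::int) = deck (n * k)"
proof -
  interpret group lift_group
    by (rule group_lift_group)
  have pow: "deck n [^]\<^bsub>lift_group\<^esub> (k::nat) = deck (n * int k)" for n k
    by (induction k) (simp_all add: deck_0 deck_mult algebra_simps)
  have "inv\<^bsub>lift_group\<^esub> deck m = deck (- m)" for m
    by (rule inv_equality) (simp_all add: deck_mult deck_0 deck_carrier)
  then show ?thesis
    by (cases k) (simp_all only: int_pow_int pow int_pow_neg deck_carrier mult_minus_right)
qed

text \<open>A branch over the identity is a logarithm of 1, so its value at one point of the domain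
  is a multiple of 2 pi i, and that value determines it.\<close>

lemma lift_over_one_is_deck:
  assumes "(mat 1, L) \<in> carrier lift_group"
  obtains n where "(mat 1, L) = deck n"
proof -
  let ?\<tau> = "vector [-1, 0] :: complex^2"
  have "exp (L ?\<tau>) = exp 0"
    using assms siegel_domain_nonempty by (simp add: lift_group_carrier)
  then obtain n :: int where "L ?\<tau> = 0 + (of_int (2 * n) * pi) * \<i>"
    unfolding exp_eq by blast
  then have "(mat 1, L) = deck n"
    using siegel_domain_nonempty deck_carrier[of n]
    by (intro lift_group_eqI[OF assms _ _ siegel_domain_nonempty]) (auto simp: deck_def)
  then show ?thesis
    using that by blast
qed

subsection \<open>The path model of the universal cover\<close>

definition based_path :: "(real \<Rightarrow> complex^3^3) \<Rightarrow> bool" where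
  "based_path p \<longleftrightarrow> continuous_on {0..1} p \<and> (\<forall>t\<in>{0..1}. p t \<in> SU21) \<and> p 0 = mat 1"

lemma based_path_iff: "based_path p \<longleftrightarrow> path p \<and> path_image p \<subseteq> SU21 \<and> pathstart p = mat 1"
  by (auto simp: based_path_def path_def path_image_def pathstart_def)

lemma cover_carrier: "carrier SU21_cover = path_class ` Collect based_path"
  by (auto simp: SU21_cover_def based_path_iff)

lemma cover_one: "\<one>\<^bsub>SU21_cover\<^esub> = path_class (\<lambda>t. mat 1)"
  by (simp add: SU21_cover_def)

lemma path_class_self: "based_path p \<Longrightarrow> p \<in> path_class p"
  by (simp add: path_class_def based_path_iff)

lemma path_class_eqI: "homotopic_paths SU21 p q \<Longrightarrow> path_class p = path_class q"
  by (simp add: path_class_def set_eq_iff) (meson homotopic_paths_sym homotopic_paths_trans)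

lemma based_path_mem: "based_path p \<Longrightarrow> p 1 \<in> SU21"
  by (simp add: based_path_def)

lemma based_path_mult: "based_path p \<Longrightarrow> based_path q \<Longrightarrow> based_path (\<lambda>t. p t ** q t)"
  by (simp add: based_path_def SU21_mult continuous_on_matrix_mult)

lemma SU21_inverse_one: "SU21_inverse (mat 1) = mat 1"
  by (simp add: SU21_inverse_def conj_transpose_one J_form_squared)

lemma based_path_inverse: "based_path p \<Longrightarrow> based_path (\<lambda>t. SU21_inverse (p t))"
  by (simp add: based_path_def SU21_inverse_closed continuous_on_SU21_inverse SU21_inverse_one)

lemma based_path_one: "based_path (\<lambda>t. mat 1)"
  by (simp add: based_path_def SU21_one)

text \<open>Multiplying the two homotopies pointwise keeps the endpoints fixed; this makes the
  product of classes well defined.\<close>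

lemma homotopic_paths_matrix_mult:
  assumes "homotopic_paths SU21 p p'" "homotopic_paths SU21 q q'"
  shows "homotopic_paths SU21 (\<lambda>t. p t ** q t) (\<lambda>t. p' t ** q' t)"
proof -
  obtain h where h: "continuous_on ({0..1} \<times> {0..1}) h" "h \<in> ({0..1} \<times> {0..1}) \<rightarrow> SU21"
    "\<forall>x \<in> {0..1}. h (0, x) = p x" "\<forall>x \<in> {0..1}. h (1, x) = p' x"
    "\<forall>t \<in> {0..1::real}. pathstart (h \<circ> Pair t) = pathstart p \<and> pathfinish (h \<circ> Pair t) = pathfinish p"
    using assms(1) unfolding homotopic_paths by blast
  obtain k where k: "continuous_on ({0..1} \<times> {0..1}) k" "k \<in> ({0..1} \<times> {0..1}) \<rightarrow> SU21"
    "\<forall>x \<in> {0..1}. k (0, x) = q x" "\<forall>x \<in> {0..1}. k (1, x) = q' x"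
    "\<forall>t \<in> {0..1::real}. pathstart (k \<circ> Pair t) = pathstart q \<and> pathfinish (k \<circ> Pair t) = pathfinish q"
    using assms(2) unfolding homotopic_paths by blast
  show ?thesis
    unfolding homotopic_paths
  proof (intro exI[of _ "\<lambda>x. h x ** k x"] conjI)
    show "continuous_on ({0..1} \<times> {0..1}) (\<lambda>x. h x ** k x)"
      by (intro continuous_intros h k)
    show "(\<lambda>x. h x ** k x) \<in> {0..1} \<times> {0..1} \<rightarrow> SU21"
      using h(2) k(2) by (auto simp: Pi_iff intro!: SU21_mult)
  qed (use h(3-) k(3-) in \<open>auto simp: pathstart_def pathfinish_def\<close>)
qed

text \<open>All members of the double union in the group law are the same class, and both index sets
  are inhabited, so the union collapses.\<close>

lemma cover_mult:
  assumes "based_path p" "based_path q"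
  shows "path_class p \<otimes>\<^bsub>SU21_cover\<^esub> path_class q = path_class (\<lambda>t. p t ** q t)"
proof -
  have "path_class (\<lambda>t. p' t ** q' t) = path_class (\<lambda>t. p t ** q t)"
    if "p' \<in> path_class p" "q' \<in> path_class q" for p' q'
  proof (rule path_class_eqI[OF homotopic_paths_sym[OF homotopic_paths_matrix_mult]])
    show "homotopic_paths SU21 p p'" "homotopic_paths SU21 q q'"
      using that by (simp_all add: path_class_def)
  qed
  then have "path_class p \<otimes>\<^bsub>SU21_cover\<^esub> path_class q
      = (\<Union>p'\<in>path_class p. \<Union>q'\<in>path_class q. path_class (\<lambda>t. p t ** q t))"
    by (simp add: SU21_cover_def)
  then show ?thesis
    using assms[THEN path_class_self] by blast
qed

lemma group_cover: "group SU21_cover"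
proof (rule groupI)
  show "\<one>\<^bsub>SU21_cover\<^esub> \<in> carrier SU21_cover"
    by (simp add: cover_carrier cover_one based_path_one)
  show "x \<otimes>\<^bsub>SU21_cover\<^esub> y \<in> carrier SU21_cover"
    if "x \<in> carrier SU21_cover" "y \<in> carrier SU21_cover" for x y
    using that by (auto simp: cover_carrier cover_mult based_path_mult)
  show "x \<otimes>\<^bsub>SU21_cover\<^esub> y \<otimes>\<^bsub>SU21_cover\<^esub> z = x \<otimes>\<^bsub>SU21_cover\<^esub> (y \<otimes>\<^bsub>SU21_cover\<^esub> z)"
    if "x \<in> carrier SU21_cover" "y \<in> carrier SU21_cover" "z \<in> carrier SU21_cover" for x y z
    using that by (auto simp: cover_carrier cover_mult based_path_mult matrix_mul_assoc)
  show "\<one>\<^bsub>SU21_cover\<^esub> \<otimes>\<^bsub>SU21_cover\<^esub> x = x" if "x \<in> carrier SU21_cover" for x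
    using that by (auto simp: cover_carrier cover_mult cover_one based_path_one)
  show "\<exists>y\<in>carrier SU21_cover. y \<otimes>\<^bsub>SU21_cover\<^esub> x = \<one>\<^bsub>SU21_cover\<^esub>"
    if x: "x \<in> carrier SU21_cover" for x
  proof -
    obtain p where p: "based_path p" "x = path_class p"
      using x by (auto simp: cover_carrier)
    let ?q = "\<lambda>t. SU21_inverse (p t)"
    \<comment> \<open>The product equals \<open>mat 1\<close> only on the unit interval, since
      \<open>p\<close> is unconstrained outside it; hence a homotopy in place of an equality of
      functions.\<close>
    have "homotopic_paths SU21 (\<lambda>t. ?q t ** p t) (\<lambda>t. mat 1)"
      using p(1) based_path_mult[OF based_path_inverse p(1)]
      by (intro homotopic_paths_eq) (auto simp: based_path_iff path_image_def image_subset_iff SU21_left_inverse SU21_one)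
    then have "path_class ?q \<otimes>\<^bsub>SU21_cover\<^esub> x = \<one>\<^bsub>SU21_cover\<^esub>"
      using p by (simp add: cover_mult based_path_inverse cover_one path_class_eqI)
    then show ?thesis
      using based_path_inverse[OF p(1)] by (auto simp: cover_carrier)
  qed
qed

lemma cover_proj_path_class: "based_path p \<Longrightarrow> cover_proj (path_class p) = p 1"
proof -
  assume p: "based_path p"
  have "pathfinish ` path_class p = {p 1}"
    using path_class_self[OF p] homotopic_paths_imp_pathfinish
    by (fastforce simp: path_class_def pathfinish_def)
  then show ?thesis
    by (simp add: cover_proj_def)
qed

section \<open>Continuation of the logarithm along paths\<close>

text \<open>\<open>L\<close> is the end of the continuation of log j along \<open>p\<close> from the
  value 0 at the identity, continuous jointly in time and point. The value 0 off the domain matches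
  the convention of \<open>lift_group\<close>.\<close>

definition branch_along :: "(real \<Rightarrow> complex^3^3) \<Rightarrow> (complex^2 \<Rightarrow> complex) \<Rightarrow> bool" where
  "branch_along p L \<longleftrightarrow>
    (\<exists>G. continuous_on ({0..1} \<times> siegel_domain) G \<and>
      (\<forall>t\<in>{0..1}. \<forall>\<tau>\<in>siegel_domain. exp (G (t, \<tau>)) = j_factor (p t) \<tau>) \<and>
      (\<forall>\<tau>\<in>siegel_domain. G (0, \<tau>) = 0 \<and> G (1, \<tau>) = L \<tau>)) \<and>
    (\<forall>\<tau>. \<tau> \<notin> siegel_domain \<longrightarrow> L \<tau> = 0)"

lemma ex_continuous_log:
  fixes f :: "'a::real_normed_vector \<Rightarrow> complex"
  assumes "continuous_on S f" "convex S" "\<forall>x\<in>S. f x \<noteq> 0"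
  shows "\<exists>g. continuous_on S g \<and> (\<forall>x\<in>S. f x = exp (g x))"
  by (rule continuous_logarithm_on_contractible[OF assms(1) convex_imp_contractible[OF assms(2)]])
    (use assms(3) in auto)

lemma branch_along_exists:
  assumes "based_path p"
  obtains L where "branch_along p L"
proof -
  let ?S = "{0..1::real} \<times> siegel_domain"
  have p: "continuous_on {0..1} p" "\<And>t. t \<in> {0..1} \<Longrightarrow> p t \<in> SU21" "p 0 = mat 1"
    using assms by (auto simp: based_path_def)
  have "continuous_on ?S (\<lambda>x. j_factor (p (fst x)) (snd x))"
    by (intro continuous_intros continuous_on_compose2[OF p(1)]) auto
  moreover have "convex ?S"
    by (intro convex_Times convex_siegel_domain) simp
  moreover have "\<forall>x\<in>?S. j_factor (p (fst x)) (snd x) \<noteq> 0"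
    using j_factor_nonzero[OF p(2)] by auto
  ultimately have "\<exists>K. continuous_on ?S K \<and> (\<forall>x\<in>?S. j_factor (p (fst x)) (snd x) = exp (K x))"
    by (rule ex_continuous_log)
  then obtain K where K: "continuous_on ?S K"
    "\<And>x. x \<in> ?S \<Longrightarrow> j_factor (p (fst x)) (snd x) = exp (K x)"
    by blast
  \<comment> \<open>\<open>K (0, snd x)\<close> is a logarithm of 1; subtracting it keeps the
    exponential and makes the continuation start at 0.\<close>
  define G where "G x = K x - K (0, snd x)" for x
  define L where "L \<tau> = (if \<tau> \<in> siegel_domain then G (1, \<tau>) else 0)" for \<tau>
  have "continuous_on ?S G"
    unfolding G_def by (intro continuous_intros K(1) continuous_on_compose2[OF K(1)]) auto
  moreover have "exp (G (t, \<tau>)) = j_factor (p t) \<tau>" if "t \<in> {0..1}" "\<tau> \<in> siegel_domain" for t \<tau>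
    using K(2)[of "(t, \<tau>)"] K(2)[of "(0, \<tau>)"] that by (simp add: G_def exp_diff p(3))
  ultimately have "branch_along p L"
    unfolding branch_along_def by (intro conjI exI[of _ G]) (auto simp: G_def L_def)
  then show ?thesis
    using that by blast
qed

text \<open>For a fixed point, a logarithm \<open>K\<close> of the automorphy factor exists over the
  whole homotopy square. Each end value is a difference of \<open>K\<close> at two corners, and
  \<open>K\<close> is constant along the two sides where the homotopy rests at an endpoint.\<close>

lemma branch_along_homotopic:
  assumes "homotopic_paths SU21 p q" "branch_along p L" "branch_along q M"
  shows "L = M"
proof
  fix \<tau>
  show "L \<tau> = M \<tau>"
  proof (cases "\<tau> \<in> siegel_domain")
    case \<tau>: True
    let ?I = "{0..1::real}"
    obtain h where h: "continuous_on (?I \<times> ?I) h" "h \<in> (?I \<times> ?I) \<rightarrow> SU21"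
      "\<forall>x \<in> ?I. h (0, x) = p x" "\<forall>x \<in> ?I. h (1, x) = q x"
      "\<forall>t \<in> ?I. pathstart (h \<circ> Pair t) = pathstart p \<and> pathfinish (h \<circ> Pair t) = pathfinish p"
      using assms(1) unfolding homotopic_paths by blast
    have h0: "h (s, 0) = p 0" and h1: "h (s, 1) = p 1" if "s \<in> ?I" for s
      using h(5) that by (auto simp: pathstart_def pathfinish_def)
    have "continuous_on (?I \<times> ?I) (\<lambda>x. j_factor (h x) \<tau>)"
      by (intro continuous_intros h)
    moreover have "convex (?I \<times> ?I)"
      by (intro convex_Times) simp_all
    moreover have "\<forall>x\<in>?I \<times> ?I. j_factor (h x) \<tau> \<noteq> 0"
      using j_factor_nonzero[OF _ \<tau>] h(2) by (metis PiE)
    ultimately have "\<exists>K. continuous_on (?I \<times> ?I) K \<and> (\<forall>x\<in>?I \<times> ?I. j_factor (h x) \<tau> = exp (K x))"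
      by (rule ex_continuous_log)
    then obtain K where K: "continuous_on (?I \<times> ?I) K"
      "\<And>x. x \<in> ?I \<times> ?I \<Longrightarrow> j_factor (h x) \<tau> = exp (K x)"
      by blast
    \<comment> \<open>On row \<open>s\<close>, the continuation \<open>G\<close> and
      \<open>K\<close> minus its initial value are logarithms of the same function and agree at time
      0.\<close>
    have val: "N \<tau> = K (s, 1) - K (s, 0)" if s: "s \<in> ?I" and N: "branch_along r N"
      and r: "\<forall>x\<in>?I. h (s, x) = r x" for s r N
    proof -
      obtain G where G: "continuous_on (?I \<times> siegel_domain) G"
        "\<forall>t\<in>?I. \<forall>\<tau>\<in>siegel_domain. exp (G (t, \<tau>)) = j_factor (r t) \<tau>"
        "\<forall>\<tau>\<in>siegel_domain. G (0, \<tau>) = 0 \<and> G (1, \<tau>) = N \<tau>"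
        using N unfolding branch_along_def by blast
      have eK: "exp (K (s, t)) = exp (G (t, \<tau>))" if "t \<in> ?I" for t
        using K(2)[of "(s, t)"] G(2) r s \<tau> that by auto
      have eK0: "exp (K (s, 0)) = 1"
        using eK[of 0] G(3) \<tau> by simp
      have "G (1, \<tau>) = K (s, 1) - K (s, 0)"
      proof (rule complex_log_unique[where S = ?I and a = 0 and f = "\<lambda>t. G (t, \<tau>)"
            and g = "\<lambda>t. K (s, t) - K (s, 0)"])
        show "continuous_on ?I (\<lambda>t. G (t, \<tau>))"
          by (rule continuous_on_compose2[OF G(1)]) (auto intro!: continuous_intros \<tau>)
        show "continuous_on ?I (\<lambda>t. K (s, t) - K (s, 0))"
          by (intro continuous_intros continuous_on_compose2[OF K(1)]) (use s in auto)
        show "exp (G (t, \<tau>)) = exp (K (s, t) - K (s, 0))" if "t \<in> ?I" for t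
          using eK[OF that] eK0 by (simp add: exp_diff)
      qed (use G(3) \<tau> in auto)
      then show ?thesis
        using G(3) \<tau> by simp
    qed
    have const: "K (1, e) = K (0, e)" if e: "e \<in> ?I" and "\<forall>s\<in>?I. h (s, e) = p e" for e
    proof (rule complex_log_unique[where S = ?I and a = 0 and f = "\<lambda>s. K (s, e)" and g = "\<lambda>s. K (0, e)"])
      show "continuous_on ?I (\<lambda>s. K (s, e))"
        by (rule continuous_on_compose2[OF K(1)]) (use e in \<open>auto intro!: continuous_intros\<close>)
      show "exp (K (s, e)) = exp (K (0, e))" if "s \<in> ?I" for s
        using K(2)[of "(s, e)"] K(2)[of "(0, e)"] that \<open>\<forall>s\<in>?I. h (s, e) = p e\<close> e by auto
    qed auto
    have "L \<tau> = K (0, 1) - K (0, 0)" "M \<tau> = K (1, 1) - K (1, 0)"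
      by (rule val[OF _ assms(2)] val[OF _ assms(3)]; use h in simp)+
    then show ?thesis
      using const[of 0] const[of 1] h0 h1 by simp
  qed (use assms in \<open>auto simp: branch_along_def\<close>)
qed

lemma branch_along_carrier:
  assumes "based_path p" "branch_along p L"
  shows "(p 1, L) \<in> carrier lift_group"
proof -
  obtain G where G: "continuous_on ({0..1} \<times> siegel_domain) G"
    "\<And>t \<tau>. t \<in> {0..1} \<Longrightarrow> \<tau> \<in> siegel_domain \<Longrightarrow> exp (G (t, \<tau>)) = j_factor (p t) \<tau>"
    "\<And>\<tau>. \<tau> \<in> siegel_domain \<Longrightarrow> G (1, \<tau>) = L \<tau>"
    using assms(2) unfolding branch_along_def by blast
  have "continuous_on siegel_domain (\<lambda>\<tau>. G (1, \<tau>))"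
    by (rule continuous_on_compose2[OF G(1)]) (auto intro!: continuous_intros)
  moreover have "continuous_on siegel_domain (\<lambda>\<tau>. G (1, \<tau>)) \<longleftrightarrow> continuous_on siegel_domain L"
    by (rule continuous_on_cong) (auto simp: G(3))
  ultimately have "continuous_on siegel_domain L"
    by simp
  moreover have "exp (L \<tau>) = j_factor (p 1) \<tau>" if "\<tau> \<in> siegel_domain" for \<tau>
    using G(2)[of 1 \<tau>] G(3) that by simp
  ultimately show ?thesis
    using assms by (auto simp: lift_group_carrier based_path_def branch_along_def)
qed

lemma branch_along_mult:
  assumes "based_path p" "based_path q" "branch_along p L" "branch_along q M"
  shows "branch_along (\<lambda>t. p t ** q t)
    (\<lambda>\<tau>. if \<tau> \<in> siegel_domain then L (siegel_act (q 1) \<tau>) + M \<tau> else 0)"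
proof -
  let ?S = "{0..1::real} \<times> siegel_domain"
  have p: "continuous_on {0..1} p" "\<And>t. t \<in> {0..1} \<Longrightarrow> p t \<in> SU21" "p 0 = mat 1"
    and q: "continuous_on {0..1} q" "\<And>t. t \<in> {0..1} \<Longrightarrow> q t \<in> SU21" "q 0 = mat 1"
    using assms by (auto simp: based_path_def)
  obtain G where G: "continuous_on ?S G"
    "\<And>t \<tau>. t \<in> {0..1} \<Longrightarrow> \<tau> \<in> siegel_domain \<Longrightarrow> exp (G (t, \<tau>)) = j_factor (p t) \<tau>"
    "\<And>\<tau>. \<tau> \<in> siegel_domain \<Longrightarrow> G (0, \<tau>) = 0" "\<And>\<tau>. \<tau> \<in> siegel_domain \<Longrightarrow> G (1, \<tau>) = L \<tau>"
    using assms(3) unfolding branch_along_def by blast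
  obtain H where H: "continuous_on ?S H"
    "\<And>t \<tau>. t \<in> {0..1} \<Longrightarrow> \<tau> \<in> siegel_domain \<Longrightarrow> exp (H (t, \<tau>)) = j_factor (q t) \<tau>"
    "\<And>\<tau>. \<tau> \<in> siegel_domain \<Longrightarrow> H (0, \<tau>) = 0" "\<And>\<tau>. \<tau> \<in> siegel_domain \<Longrightarrow> H (1, \<tau>) = M \<tau>"
    using assms(4) unfolding branch_along_def by blast
  \<comment> \<open>The cocycle rule for the automorphy factor, written additively for logarithms at
    each time.\<close>
  let ?K = "\<lambda>x. G (fst x, siegel_act (q (fst x)) (snd x)) + H x"
  have "continuous_on ?S (\<lambda>x. siegel_act (q (fst x)) (snd x))"
    by (intro continuous_intros continuous_on_compose2[OF q(1)]) (auto simp: q)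
  then have "continuous_on ?S (\<lambda>x. (fst x, siegel_act (q (fst x)) (snd x)))"
    by (rule continuous_on_Pair[OF continuous_on_fst[OF continuous_on_id]])
  then have "continuous_on ?S ?K"
    by (intro continuous_on_add H(1) continuous_on_compose2[OF G(1)])
      (auto intro!: siegel_act_closed q)
  then show ?thesis
    unfolding branch_along_def
    by (intro conjI exI[of _ ?K])
      (auto simp: exp_add G H p q siegel_act_closed j_factor_mult)
qed

text \<open>This compares the path model with the model by branches. The description is proper
  because, by \<open>branch_along_homotopic\<close>, the branch depends only on the class.\<close>

definition cover_to_lift :: "(real \<Rightarrow> complex^3^3) set \<Rightarrow> (complex^3^3) \<times> (complex^2 \<Rightarrow> complex)" where
  "cover_to_lift X = (cover_proj X, THE L. \<exists>p\<in>X. branch_along p L)"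

lemma cover_to_lift_path_class:
  assumes "based_path p" "branch_along p L"
  shows "cover_to_lift (path_class p) = (p 1, L)"
proof -
  have "(THE L. \<exists>q\<in>path_class p. branch_along q L) = L"
  proof (rule the_equality)
    show "\<exists>q\<in>path_class p. branch_along q L"
      using assms path_class_self by blast
    show "M = L" if "\<exists>q\<in>path_class p. branch_along q M" for M
      using that branch_along_homotopic[OF _ assms(2)] by (auto simp: path_class_def)
  qed
  then show ?thesis
    by (simp add: cover_to_lift_def cover_proj_path_class assms)
qed

lemma fst_cover_to_lift [simp]: "fst (cover_to_lift X) = cover_proj X"
  by (simp add: cover_to_lift_def)

lemma cover_to_lift_hom: "cover_to_lift \<in> hom SU21_cover lift_group"
proof (rule homI)
  fix x assume "x \<in> carrier SU21_cover"
  then obtain p L where p: "based_path p" "x = path_class p" and L: "branch_along p L"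
    by (auto simp: cover_carrier intro: branch_along_exists)
  show "cover_to_lift x \<in> carrier lift_group"
    using p L by (simp add: cover_to_lift_path_class branch_along_carrier)
  fix y assume "y \<in> carrier SU21_cover"
  then obtain q M where q: "based_path q" "y = path_class q" and M: "branch_along q M"
    by (auto simp: cover_carrier intro: branch_along_exists)
  show "cover_to_lift (x \<otimes>\<^bsub>SU21_cover\<^esub> y) = cover_to_lift x \<otimes>\<^bsub>lift_group\<^esub> cover_to_lift y"
    using p L q M branch_along_mult[OF p(1) q(1) L M]
    by (simp add: cover_mult cover_to_lift_path_class based_path_mult lift_group_mult)
qed

lemma cover_proj_hom: "cover_proj \<in> hom SU21_cover SU21_group"
  by (rule homI)
    (auto simp: cover_carrier cover_mult cover_proj_path_class based_path_mult SU21_group_def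
      dest: based_path_mem)

subsection \<open>Unipotent elements and the key relation\<close>

text \<open>Under the condition in \<open>unip_SU21\<close> these form the Heisenberg group fixing
  the isotropic first basis vector: the real part of \<open>c\<close> is determined by
  \<open>v\<close>, and its imaginary part is the central coordinate.\<close>

definition unip :: "complex \<Rightarrow> complex \<Rightarrow> complex^3^3" where
  "unip v c = vector [vector [1, - cnj v, c], vector [0, 1, v], vector [0, 0, 1]]"

lemma unip_SU21:
  assumes "c + cnj c = - (v * cnj v)" shows "unip v c \<in> SU21"
proof -
  have "cnj c = - (v * cnj v) - c"
    using assms by (metis add_diff_cancel_left')
  then show ?thesis
    by (simp add: SU21_def det_3 unip_def mat3_simps J_form_def)
qed

lemma unip_mult: "unip v c ** unip v' c' = unip (v + v') (c + c' - cnj v * v')"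
  by (simp add: unip_def mat3_simps algebra_simps)

lemma unip_0: "unip 0 0 = mat 1"
  by (simp add: unip_def mat3_simps)

lemma j_factor_unip [simp]: "j_factor (unip v c) \<tau> = 1"
  by (simp add: j_factor_def unip_def)

text \<open>The automorphy factor is identically 1 here, so the zero branch is a distinguished lift
  and these lifts multiply like the matrices.\<close>

definition unip_lift :: "complex \<Rightarrow> complex \<Rightarrow> (complex^3^3) \<times> (complex^2 \<Rightarrow> complex)" where
  "unip_lift v c = (unip v c, \<lambda>_. 0)"

lemma unip_lift_carrier: "c + cnj c = - (v * cnj v) \<Longrightarrow> unip_lift v c \<in> carrier lift_group"
  by (simp add: unip_lift_def lift_group_carrier unip_SU21)

lemma unip_lift_mult:
  "unip_lift v c \<otimes>\<^bsub>lift_group\<^esub> unip_lift v' c' = unip_lift (v + v') (c + c' - cnj v * v')"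
  by (auto simp: unip_lift_def lift_group_mult unip_mult)

text \<open>The path must preserve the quadratic condition on \<open>c\<close> and \<open>v\<close>:
  with \<open>v\<close> scaled by \<open>t\<close>, the real part of \<open>c\<close> scales by the
  square of \<open>t\<close>, while the imaginary part is free and scales by
  \<open>t\<close>.\<close>

lemma unip_path:
  assumes "c + cnj c = - (v * cnj v)"
  obtains p where "based_path p" "branch_along p (\<lambda>_. 0)" "p 1 = unip v c"
proof
  let ?c = "\<lambda>t::real. of_real (t\<^sup>2 * Re c) + \<i> * of_real (t * Im c)"
  let ?p = "\<lambda>t::real. unip (of_real t * v) (?c t)"
  have "2 * Re c = - (Re v * Re v + Im v * Im v)"
    using assms by (simp add: complex_eq_iff)
  then have re: "2 * (t\<^sup>2 * Re c) = - (t * Re v * (t * Re v) + t * Im v * (t * Im v))" for t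
    by (metis (no_types, opaque_lifting) distrib_left mult.assoc mult.left_commute mult_minus_right power2_eq_square)
  have mem: "?p t \<in> SU21" for t
    by (rule unip_SU21) (use re[of t] in \<open>simp add: complex_eq_iff mult_ac\<close>)
  have "continuous_on {0..1} ?p"
  proof -
    have "continuous_on {0..1} (\<lambda>t. ?p t $ i $ j)" for i j
      using exhaust_3[of i] exhaust_3[of j]
      by (elim disjE; simp add: unip_def; intro continuous_intros)
    then have "continuous_on {0..1} (\<lambda>t. \<chi> i j. ?p t $ i $ j)"
      by (intro continuous_on_vec_lambda)
    then show ?thesis
      by simp
  qed
  then show "based_path ?p"
    using mem by (simp add: based_path_def unip_0)
  show "branch_along ?p (\<lambda>_. 0)"
    unfolding branch_along_def by (intro conjI exI[of _ "\<lambda>_. 0"]) auto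
  have "?c 1 = c"
    by (simp add: complex_eq_iff)
  then show "?p 1 = unip v c"
    by simp
qed

text \<open>Conjugating a path by the fixed matrix of \<open>x\<close> again gives a path from the
  identity. So the conjugate comes from the path model without any path leading to \<open>x\<close>,
  which is how \<open>weyl_lift\<close> is handled.\<close>

lemma conj_path:
  assumes x: "x \<in> carrier lift_group" and p: "based_path p" "branch_along p L"
  obtains q where "based_path q"
    "cover_to_lift (path_class q) = x \<otimes>\<^bsub>lift_group\<^esub> (p 1, L) \<otimes>\<^bsub>lift_group\<^esub> inv\<^bsub>lift_group\<^esub> x"
proof -
  interpret group lift_group
    by (rule group_lift_group)
  let ?S = "{0..1::real} \<times> siegel_domain"
  obtain g M where g: "x = (g, M)"
    by (metis surj_pair)
  obtain h N where h: "inv\<^bsub>lift_group\<^esub> x = (h, N)"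
    by (metis surj_pair)
  have hN: "(h, N) \<in> carrier lift_group" "(g, M) \<otimes>\<^bsub>lift_group\<^esub> (h, N) = \<one>\<^bsub>lift_group\<^esub>"
    using inv_closed[OF x] r_inv[OF x] by (unfold h, unfold g)
  have gSU: "g \<in> SU21" and hSU: "h \<in> SU21" and MN: "continuous_on siegel_domain M" "continuous_on siegel_domain N"
    and eM: "\<And>\<tau>. \<tau> \<in> siegel_domain \<Longrightarrow> exp (M \<tau>) = j_factor g \<tau>"
    and eN: "\<And>\<tau>. \<tau> \<in> siegel_domain \<Longrightarrow> exp (N \<tau>) = j_factor h \<tau>"
    using x hN(1) by (auto simp: g lift_group_carrier)
  have gh: "g ** h = mat 1"
    using hN(2) by (simp add: lift_group_mult lift_group_one)
  have MN0: "M (siegel_act h \<tau>) + N \<tau> = 0" if "\<tau> \<in> siegel_domain" for \<tau>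
    using arg_cong[OF hN(2), of "\<lambda>x. snd x \<tau>"] that by (simp add: lift_group_mult lift_group_one)
  have pp: "continuous_on {0..1} p" "\<And>t. t \<in> {0..1} \<Longrightarrow> p t \<in> SU21" "p 0 = mat 1"
    using p(1) by (auto simp: based_path_def)
  obtain G where G: "continuous_on ?S G"
    "\<And>t \<tau>. t \<in> {0..1} \<Longrightarrow> \<tau> \<in> siegel_domain \<Longrightarrow> exp (G (t, \<tau>)) = j_factor (p t) \<tau>"
    "\<And>\<tau>. \<tau> \<in> siegel_domain \<Longrightarrow> G (0, \<tau>) = 0" "\<And>\<tau>. \<tau> \<in> siegel_domain \<Longrightarrow> G (1, \<tau>) = L \<tau>"
    using p(2) unfolding branch_along_def by blast
  let ?q = "\<lambda>t. g ** p t ** h"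
  \<comment> \<open>The cocycle rule for three factors, of which only the middle one moves; at time
    0 the outer branches cancel by \<open>MN0\<close>.\<close>
  let ?H = "\<lambda>x. M (siegel_act (p (fst x)) (siegel_act h (snd x))) + G (fst x, siegel_act h (snd x)) + N (snd x)"
  let ?K = "\<lambda>\<tau>. if \<tau> \<in> siegel_domain then ?H (1, \<tau>) else 0"
  have q: "based_path ?q"
    using gh gSU hSU pp
    by (auto simp: based_path_def SU21_mult intro!: continuous_intros)
  have hact: "continuous_on ?S (\<lambda>x. siegel_act h (snd x))"
    by (intro continuous_intros) (auto simp: hSU)
  then have "continuous_on ?S (\<lambda>x. (fst x, siegel_act h (snd x)))"
    by (rule continuous_on_Pair[OF continuous_on_fst[OF continuous_on_id]])
  then have "continuous_on ?S (\<lambda>x. G (fst x, siegel_act h (snd x)))"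
    by (rule continuous_on_compose2[OF G(1)]) (auto simp: siegel_act_closed hSU)
  moreover have "continuous_on ?S (\<lambda>x. siegel_act (p (fst x)) (siegel_act h (snd x)))"
    by (intro continuous_on_siegel_act hact continuous_on_compose2[OF pp(1)])
      (auto intro!: continuous_intros simp: pp siegel_act_closed hSU)
  then have "continuous_on ?S (\<lambda>x. M (siegel_act (p (fst x)) (siegel_act h (snd x))))"
    by (rule continuous_on_compose2[OF MN(1)]) (auto simp: siegel_act_closed hSU pp)
  moreover have "continuous_on ?S (\<lambda>x. N (snd x))"
    by (rule continuous_on_compose2[OF MN(2)]) (auto intro!: continuous_intros)
  ultimately have "continuous_on ?S ?H"
    by (intro continuous_on_add)
  then have "branch_along ?q ?K"
    unfolding branch_along_def
    by (intro conjI exI[of _ ?H])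
      (auto simp: exp_add eM eN G MN0 gSU hSU pp siegel_act_closed SU21_mult j_factor_mult siegel_act_mult)
  moreover have "(g ** p 1 ** h, ?K) = x \<otimes>\<^bsub>lift_group\<^esub> (p 1, L) \<otimes>\<^bsub>lift_group\<^esub> (h, N)"
    by (auto simp: g lift_group_mult siegel_act_closed hSU G)
  ultimately show ?thesis
    using that[OF q] q by (simp add: cover_to_lift_path_class h)
qed

text \<open>This is \<open>-J\<close>; the sign makes the determinant \<open>1\<close>.\<close>

definition weyl :: "complex^3^3" where
  "weyl = vector [vector [0, 0, -1], vector [0, -1, 0], vector [-1, 0, 0]]"

lemma weyl_SU21: "weyl \<in> SU21"
  by (simp add: SU21_def det_3 weyl_def mat3_simps J_form_def)

lemma weyl_squared: "weyl ** weyl = mat 1"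
  by (simp add: weyl_def mat3_simps)

lemma j_factor_weyl: "j_factor weyl \<tau> = - \<tau> $ 1"
  by (simp add: j_factor_def weyl_def)

lemma Re_siegel_domain: "\<tau> \<in> siegel_domain \<Longrightarrow> Re (\<tau> $ 1) < 0"
  by (simp add: siegel_domain_def) (smt (verit) zero_le_power2)

lemma siegel_act_weyl: "siegel_act weyl \<tau> $ 1 = inverse (\<tau> $ 1)"
  by (simp add: siegel_act_nth j_factor_weyl) (simp add: weyl_def)

text \<open>On the domain the automorphy factor of \<open>weyl\<close> has positive real part, so
  the principal logarithm is a continuous branch.\<close>

definition weyl_lift :: "(complex^3^3) \<times> (complex^2 \<Rightarrow> complex)" where
  "weyl_lift = (weyl, \<lambda>\<tau>. if \<tau> \<in> siegel_domain then Ln (- \<tau> $ 1) else 0)"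

lemma weyl_lift_carrier: "weyl_lift \<in> carrier lift_group"
proof -
  have "- \<tau> $ 1 \<notin> \<real>\<^sub>\<le>\<^sub>0" "\<tau> $ 1 \<noteq> 0" if "\<tau> \<in> siegel_domain" for \<tau> :: "complex^2"
    using Re_siegel_domain[OF that] by (auto simp: complex_nonpos_Reals_iff)
  moreover have "continuous_on siegel_domain (\<lambda>\<tau>. if \<tau> \<in> siegel_domain then Ln (- \<tau> $ 1) else 0)
    \<longleftrightarrow> continuous_on siegel_domain (\<lambda>\<tau>. Ln (- \<tau> $ 1))"
    by (rule continuous_on_cong) auto
  ultimately show ?thesis
    by (auto simp: weyl_lift_def lift_group_carrier weyl_SU21 j_factor_weyl intro!: continuous_intros)
qed

text \<open>\<open>weyl\<close> inverts the first coordinate, and the principal logarithm changes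
  sign under inversion in the right half plane, so no multiple of 2 pi i appears.\<close>

lemma weyl_lift_squared: "weyl_lift \<otimes>\<^bsub>lift_group\<^esub> weyl_lift = \<one>\<^bsub>lift_group\<^esub>"
proof -
  have "Ln (- inverse (\<tau> $ 1)) + Ln (- \<tau> $ 1) = 0" if "\<tau> \<in> siegel_domain" for \<tau> :: "complex^2"
    using Re_siegel_domain[OF that] Ln_inverse[of "- \<tau> $ 1"]
    by (auto simp: complex_nonpos_Reals_iff)
  then show ?thesis
    by (auto simp: weyl_lift_def lift_group_mult lift_group_one weyl_squared siegel_act_weyl
        siegel_act_closed weyl_SU21)
qed

section \<open>Eisenstein arithmetic and the elliptic element\<close>

lemma zeta3_squared: "zeta3 * zeta3 = - 1 - zeta3"
  and cnj_zeta3: "cnj zeta3 = - 1 - zeta3"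
  and sqrt_minus_3_eq: "sqrt_minus_3 = 1 + 2 * zeta3"
  and zeta3_plus_1: "1 + zeta3 = exp (\<i> * of_real (pi / 3))"
  and Re_zeta3: "Re zeta3 = - 1 / 2"
proof -
  define w where "w = exp (\<i> * complex_of_real (pi / 3))"
  have w: "w = Complex (1 / 2) (sqrt 3 / 2)"
    by (simp add: w_def cis_def cos_60 sin_60 complex_eq_iff del: of_real_divide flip: cis_conv_exp)
  have "zeta3 = w * w"
    by (simp add: w_def zeta3_def mult_ac flip: exp_add)
  then have z: "zeta3 = Complex (- 1 / 2) (sqrt 3 / 2)"
    by (simp add: w complex_eq_iff)
  show "zeta3 * zeta3 = - 1 - zeta3" "cnj zeta3 = - 1 - zeta3" "sqrt_minus_3 = 1 + 2 * zeta3"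
    "1 + zeta3 = exp (\<i> * of_real (pi / 3))" "Re zeta3 = - 1 / 2"
    unfolding w_def[symmetric] by (simp_all add: z w sqrt_minus_3_def complex_eq_iff)
qed

lemma zeta3_mult_left: "zeta3 * (zeta3 * x) = - x - zeta3 * x"
  using arg_cong[OF zeta3_squared, of "\<lambda>y. y * x"] by (simp add: algebra_simps)

lemma zeta3_plus_1_nonzero: "zeta3 + 1 \<noteq> 0" "1 + zeta3 \<noteq> 0"
  using zeta3_plus_1 by (simp_all add: add.commute)

lemma cnj_sqrt_minus_3: "cnj sqrt_minus_3 = - sqrt_minus_3"
  by (simp add: sqrt_minus_3_def)

lemma sqrt_minus_3_squared: "sqrt_minus_3 * sqrt_minus_3 = - 3"
  by (simp add: sqrt_minus_3_eq algebra_simps zeta3_squared zeta3_mult_left)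

text \<open>
  \<open>trans_lift\<close> is central among the unipotent lifts and its cube is the commutator of \<open>alpha_lift\<close>
  and \<open>beta_lift\<close>. The translation by \<open>-sqrt_minus_3\<close> is chosen so that its product with its
  conjugate under \<open>weyl\<close> has trace \<open>-1\<close> on the hyperbolic plane, hence order \<open>3\<close>.
\<close>

abbreviation "trans_lift \<equiv> unip_lift 0 (- sqrt_minus_3)"
abbreviation "alpha_lift \<equiv> unip_lift sqrt_minus_3 (sqrt_minus_3 * zeta3)"
abbreviation "beta_lift \<equiv> unip_lift (sqrt_minus_3 * zeta3) (sqrt_minus_3 * zeta3)"

lemma unip_params:
  "- sqrt_minus_3 + cnj (- sqrt_minus_3) = - (0 * cnj 0)"
  "sqrt_minus_3 * zeta3 + cnj (sqrt_minus_3 * zeta3) = - (sqrt_minus_3 * cnj sqrt_minus_3)"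
  "sqrt_minus_3 * zeta3 + cnj (sqrt_minus_3 * zeta3) = - ((sqrt_minus_3 * zeta3) * cnj (sqrt_minus_3 * zeta3))"
  by (simp_all add: sqrt_minus_3_eq cnj_zeta3 algebra_simps zeta3_squared zeta3_mult_left)

lemma trans_lift_cubed:
  "trans_lift \<otimes>\<^bsub>lift_group\<^esub> trans_lift \<otimes>\<^bsub>lift_group\<^esub> trans_lift \<otimes>\<^bsub>lift_group\<^esub> (beta_lift \<otimes>\<^bsub>lift_group\<^esub> alpha_lift)
    = alpha_lift \<otimes>\<^bsub>lift_group\<^esub> beta_lift"
  unfolding unip_lift_mult
  by (intro arg_cong2[of _ _ _ _ unip_lift])
    (simp_all add: sqrt_minus_3_eq cnj_zeta3 algebra_simps zeta3_squared zeta3_mult_left)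

text \<open>
  The fixed point of \<open>ell_lift\<close> below, whose square is the order-\<open>3\<close> product just mentioned; at this
  point branches can be read off as arguments of eigenvalues.
\<close>

definition tau0 :: "complex^2" where
  "tau0 = vector [zeta3, 0]"

lemma tau0_mem: "tau0 \<in> siegel_domain"
  by (simp add: tau0_def siegel_domain_def Re_zeta3)

abbreviation "ell_lift \<equiv> weyl_lift \<otimes>\<^bsub>lift_group\<^esub> trans_lift"

lemma ell_mat:
  "weyl ** unip 0 (- sqrt_minus_3) = vector [vector [0, 0, -1], vector [0, -1, 0], vector [-1, 0, sqrt_minus_3]]"
  by (simp add: weyl_def unip_def mat3_simps)

lemma ell_fixes: "siegel_act (fst ell_lift) tau0 = tau0"
  by (simp add: weyl_lift_def unip_lift_def ell_mat vec_eq_iff forall_2 siegel_act_nth)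
    (simp add: j_factor_def tau0_def sqrt_minus_3_eq field_simps zeta3_squared zeta3_plus_1_nonzero)

text \<open>The translation sends \<open>tau0\<close> to a point with first coordinate
  \<open>- (1 + zeta3)\<close>, so the logarithm in \<open>weyl_lift\<close> is taken at a sixth
  root of unity of argument pi / 3, within the principal range.\<close>

lemma ell_log: "snd ell_lift tau0 = \<i> * of_real (pi / 3)"
proof -
  have "siegel_act (unip 0 (- sqrt_minus_3)) tau0 $ 1 = - (1 + zeta3)"
    by (simp add: siegel_act_nth) (simp add: unip_def tau0_def sqrt_minus_3_eq)
  moreover have "Ln (1 + zeta3) = \<i> * of_real (pi / 3)"
    unfolding zeta3_plus_1 by (rule Ln_exp) (simp_all)
  ultimately show ?thesis
    using siegel_act_closed[OF unip_SU21[OF unip_params(1)] tau0_mem]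
    by (simp add: snd_lift_group_mult tau0_mem weyl_lift_def unip_lift_def add.commute)
qed

text \<open>Since \<open>tau0\<close> is fixed, branch values there add under multiplication: six
  factors contribute pi i / 3 each, in total 2 pi i, while the matrix of \<open>m\<close> has cube
  1.\<close>

lemma ell_pow:
  fixes m
  defines "m \<equiv> ell_lift \<otimes>\<^bsub>lift_group\<^esub> ell_lift"
  shows "m \<otimes>\<^bsub>lift_group\<^esub> m \<otimes>\<^bsub>lift_group\<^esub> m = deck 1"
proof (rule lift_group_eqI[OF _ _ _ tau0_mem])
  have ell: "ell_lift \<in> carrier lift_group"
    by (intro lift_group_mult_closed weyl_lift_carrier unip_lift_carrier unip_params)
  then have "m \<in> carrier lift_group"
    unfolding m_def by (intro lift_group_mult_closed[OF ell ell])
  then show "m \<otimes>\<^bsub>lift_group\<^esub> m \<otimes>\<^bsub>lift_group\<^esub> m \<in> carrier lift_group"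
    by (intro lift_group_mult_closed)
  show "deck 1 \<in> carrier lift_group"
    by (rule deck_carrier)
  have fm: "fst m = vector [vector [1, 0, - sqrt_minus_3], vector [0, 1, 0], vector [- sqrt_minus_3, 0, -2]]"
    unfolding m_def fst_lift_group_mult
    by (simp add: weyl_lift_def unip_lift_def ell_mat) (simp add: mat3_simps sqrt_minus_3_squared)
  show "fst (m \<otimes>\<^bsub>lift_group\<^esub> m \<otimes>\<^bsub>lift_group\<^esub> m) = fst (deck 1)"
    unfolding fst_lift_group_mult fm
    by (simp add: deck_def mat3_simps sqrt_minus_3_squared)
  have "fst ell_lift \<in> SU21"
    using ell by (cases ell_lift) (simp add: lift_group_carrier)
  then have act: "siegel_act (fst m) tau0 = tau0"
    unfolding m_def fst_lift_group_mult[of ell_lift]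
    by (simp only: siegel_act_mult tau0_mem ell_fixes)
  have "snd m tau0 = 2 * (\<i> * of_real (pi / 3))"
    unfolding m_def snd_lift_group_mult[OF tau0_mem, of ell_lift] ell_fixes ell_log by simp
  then show "snd (m \<otimes>\<^bsub>lift_group\<^esub> m \<otimes>\<^bsub>lift_group\<^esub> m) tau0 = snd (deck 1) tau0"
    by (simp only: snd_lift_group_mult[OF tau0_mem] act) (simp add: deck_def tau0_mem)
qed

section \<open>Cubes modulo commutators\<close>

text \<open>In the abelianization the cube of a product is the product of the cubes.\<close>

lemma (in group) cube_mult_mem_derived:
  assumes "x \<in> carrier G" "y \<in> carrier G"
    and "x \<otimes> x \<otimes> x \<in> derived G (carrier G)" "y \<otimes> y \<otimes> y \<in> derived G (carrier G)"
  shows "x \<otimes> y \<otimes> (x \<otimes> y) \<otimes> (x \<otimes> y) \<in> derived G (carrier G)"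
proof -
  let ?D = "derived G (carrier G)"
  interpret D: normal ?D G
    by (rule derived_self_is_normal)
  interpret Q: comm_group "G Mod ?D"
    by (rule derived_quot_is_comm_group)
  interpret h: group_hom G "G Mod ?D" "\<lambda>a. ?D #> a"
    by unfold_locales (rule D.r_coset_hom_Mod)
  have one: "a \<in> ?D \<longleftrightarrow> ?D #> a = \<one>\<^bsub>G Mod ?D\<^esub>" if "a \<in> carrier G" for a
    using that coset_join1[OF _ that D.subgroup_axioms] coset_join2[OF that D.subgroup_axioms]
    by (auto simp: FactGroup_def)
  have c: "?D #> x \<in> carrier (G Mod ?D)" "?D #> y \<in> carrier (G Mod ?D)"
    using assms(1,2) by auto
  have "?D #> (x \<otimes> y \<otimes> (x \<otimes> y) \<otimes> (x \<otimes> y)) = (?D #> (x \<otimes> x \<otimes> x)) \<otimes>\<^bsub>G Mod ?D\<^esub> (?D #> (y \<otimes> y \<otimes> y))"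
    using assms(1,2) c by (simp add: Q.m_ac del: mult_FactGroup)
  also have "?D #> (x \<otimes> x \<otimes> x) = \<one>\<^bsub>G Mod ?D\<^esub>"
    by (intro iffD1[OF one] m_closed assms)
  also have "?D #> (y \<otimes> y \<otimes> y) = \<one>\<^bsub>G Mod ?D\<^esub>"
    by (intro iffD1[OF one] m_closed assms)
  also have "\<one>\<^bsub>G Mod ?D\<^esub> \<otimes>\<^bsub>G Mod ?D\<^esub> \<one>\<^bsub>G Mod ?D\<^esub> = \<one>\<^bsub>G Mod ?D\<^esub>"
    by (rule Q.l_one[OF Q.one_closed])
  finally show ?thesis
    using one assms(1,2) by simp
qed

text \<open>The relation says that the cube of \<open>s\<close> is the commutator of
  \<open>a\<close> and \<open>b\<close>. Its inverse-free form is the one that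
  \<open>trans_lift_cubed\<close> obtains from the multiplication rule alone.\<close>

lemma (in group) cube_mem_derived:
  assumes "a \<in> carrier G" "b \<in> carrier G" "s \<in> carrier G"
    and "s \<otimes> s \<otimes> s \<otimes> (b \<otimes> a) = a \<otimes> b"
  shows "s \<otimes> s \<otimes> s \<in> derived G (carrier G)"
proof -
  have "s \<otimes> s \<otimes> s = (a \<otimes> b) \<otimes> inv (b \<otimes> a)"
    using assms by (intro inv_solve_right[THEN iffD2]) auto
  then have "s \<otimes> s \<otimes> s = a \<otimes> b \<otimes> inv a \<otimes> inv b"
    using assms by (simp add: inv_mult_group m_assoc)
  then have "s \<otimes> s \<otimes> s \<in> derived_set G (carrier G)"
    using assms(1,2) by blast
  then show ?thesis
    unfolding derived_def by (rule generate.incl)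
qed

text \<open>This is conjugation, because \<open>weyl_lift\<close> is its own inverse.\<close>

abbreviation weyl_conj where
  "weyl_conj x \<equiv> weyl_lift \<otimes>\<^bsub>lift_group\<^esub> x \<otimes>\<^bsub>lift_group\<^esub> weyl_lift"

lemma unip_lifts_carrier:
  "trans_lift \<in> carrier lift_group" "alpha_lift \<in> carrier lift_group" "beta_lift \<in> carrier lift_group"
  by (rule unip_lift_carrier unip_params)+

text \<open>\<open>K\<close> is general so that it can be the preimage of the arithmetic group in
  \<open>lift_group\<close> or the image of its preimage in the path model. The conjugates are
  assumed in \<open>K\<close> instead of \<open>weyl_lift\<close>, as \<open>weyl\<close> is not
  congruent to the identity modulo \<open>sqrt_minus_3\<close>.\<close>

lemma deck_1_mem_derived:
  assumes K: "subgroup K lift_group"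
    and mem: "trans_lift \<in> K" "alpha_lift \<in> K" "beta_lift \<in> K"
      "weyl_conj trans_lift \<in> K" "weyl_conj alpha_lift \<in> K" "weyl_conj beta_lift \<in> K"
  shows "deck 1 \<in> derived lift_group K"
proof -
  interpret group lift_group
    by (rule group_lift_group)
  let ?G = "lift_group\<lparr>carrier := K\<rparr>"
  interpret K: group ?G
    by (rule subgroup_imp_group[OF K])
  have conj: "weyl_conj x \<otimes>\<^bsub>lift_group\<^esub> weyl_conj y = weyl_conj (x \<otimes>\<^bsub>lift_group\<^esub> y)"
    if "x \<in> carrier lift_group" "y \<in> carrier lift_group" for x y
  proof -
    have "weyl_conj x \<otimes>\<^bsub>lift_group\<^esub> weyl_conj y = weyl_lift \<otimes>\<^bsub>lift_group\<^esub> x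
        \<otimes>\<^bsub>lift_group\<^esub> (weyl_lift \<otimes>\<^bsub>lift_group\<^esub> weyl_lift) \<otimes>\<^bsub>lift_group\<^esub> y \<otimes>\<^bsub>lift_group\<^esub> weyl_lift"
      using that weyl_lift_carrier by (simp add: m_assoc)
    then show ?thesis
      using that weyl_lift_carrier by (simp add: weyl_lift_squared m_assoc)
  qed
  note c = unip_lifts_carrier
  have "weyl_conj trans_lift \<otimes>\<^bsub>lift_group\<^esub> weyl_conj trans_lift \<otimes>\<^bsub>lift_group\<^esub> weyl_conj trans_lift
      \<otimes>\<^bsub>lift_group\<^esub> (weyl_conj beta_lift \<otimes>\<^bsub>lift_group\<^esub> weyl_conj alpha_lift)
      = weyl_conj alpha_lift \<otimes>\<^bsub>lift_group\<^esub> weyl_conj beta_lift"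
    using trans_lift_cubed c by (simp only: conj m_closed)
  then have "weyl_conj trans_lift \<otimes>\<^bsub>?G\<^esub> weyl_conj trans_lift \<otimes>\<^bsub>?G\<^esub> weyl_conj trans_lift \<in> derived ?G (carrier ?G)"
    by (intro K.cube_mem_derived[of "weyl_conj alpha_lift" "weyl_conj beta_lift"]) (simp_all add: mem)
  moreover have "trans_lift \<otimes>\<^bsub>?G\<^esub> trans_lift \<otimes>\<^bsub>?G\<^esub> trans_lift \<in> derived ?G (carrier ?G)"
    by (intro K.cube_mem_derived[of alpha_lift beta_lift]) (simp_all add: mem trans_lift_cubed)
  \<comment> \<open>Regrouping turns the product of the two elements with known cubes into the
    square of \<open>ell_lift\<close>, to which \<open>ell_pow\<close> applies.\<close>
  moreover have "weyl_conj trans_lift \<otimes>\<^bsub>lift_group\<^esub> trans_lift = ell_lift \<otimes>\<^bsub>lift_group\<^esub> ell_lift"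
    using weyl_lift_carrier c by (simp add: m_assoc)
  ultimately have "deck 1 \<in> derived ?G (carrier ?G)"
    using K.cube_mult_mem_derived[of "weyl_conj trans_lift" trans_lift] mem ell_pow by simp
  then show ?thesis
    using derived_consistent[OF _ K] by simp
qed

subsection \<open>The arithmetic subgroups\<close>

lemma Eisenstein_intI: "of_int m + of_int n * zeta3 \<in> Eisenstein_ints"
  by (auto simp: Eisenstein_ints_def)

lemma Eisenstein_ints_0 [simp]: "0 \<in> Eisenstein_ints"
  and Eisenstein_ints_1 [simp]: "1 \<in> Eisenstein_ints"
  and Eisenstein_ints_zeta3 [simp]: "zeta3 \<in> Eisenstein_ints"
  and Eisenstein_ints_sqrt_minus_3 [simp]: "sqrt_minus_3 \<in> Eisenstein_ints"
  using Eisenstein_intI[of 0 0] Eisenstein_intI[of 1 0] Eisenstein_intI[of 0 1] Eisenstein_intI[of 1 2]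
  by (simp_all add: sqrt_minus_3_eq)

lemma Eisenstein_ints_add [simp, intro]:
  assumes "x \<in> Eisenstein_ints" "y \<in> Eisenstein_ints" shows "x + y \<in> Eisenstein_ints"
proof -
  obtain a b c d :: int where "x = of_int a + of_int b * zeta3" "y = of_int c + of_int d * zeta3"
    using assms by (auto simp: Eisenstein_ints_def)
  then have "x + y = of_int (a + c) + of_int (b + d) * zeta3"
    by (simp add: algebra_simps)
  then show ?thesis
    by (metis Eisenstein_intI)
qed

lemma Eisenstein_ints_mult [simp, intro]:
  assumes "x \<in> Eisenstein_ints" "y \<in> Eisenstein_ints" shows "x * y \<in> Eisenstein_ints"
proof -
  obtain a b c d :: int where "x = of_int a + of_int b * zeta3" "y = of_int c + of_int d * zeta3"
    using assms by (auto simp: Eisenstein_ints_def)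
  then have "x * y = of_int (a * c - b * d) + of_int (a * d + b * c - b * d) * zeta3"
    by (simp add: algebra_simps zeta3_squared zeta3_mult_left)
  then show ?thesis
    by (metis Eisenstein_intI)
qed

lemma Eisenstein_ints_uminus [simp, intro]:
  assumes "x \<in> Eisenstein_ints" shows "- x \<in> Eisenstein_ints"
  using Eisenstein_ints_mult[OF Eisenstein_intI[of "-1" 0] assms] by simp

lemma Eisenstein_ints_cnj [simp, intro]:
  assumes "x \<in> Eisenstein_ints" shows "cnj x \<in> Eisenstein_ints"
proof -
  obtain a b :: int where "x = of_int a + of_int b * zeta3"
    using assms by (auto simp: Eisenstein_ints_def)
  then have "cnj x = of_int (a - b) + of_int (- b) * zeta3"
    by (simp add: algebra_simps cnj_zeta3)
  then show ?thesis
    by (metis Eisenstein_intI)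
qed

section \<open>Congruence subgroups and the unipotent elements in them\<close>

text \<open>Choice collects the quotients of the congruences into one coefficient function;
  integrality of the entries then follows from the congruences.\<close>

lemma Gamma_sqrt_minus_3_iff:
  "g \<in> Gamma_sqrt_minus_3 \<longleftrightarrow> g \<in> SU21 \<and>
    (\<exists>A. \<forall>i j. A i j \<in> Eisenstein_ints \<and> g $ i $ j = mat 1 $ i $ j + sqrt_minus_3 * A i j)"
  (is "_ \<longleftrightarrow> _ \<and> ?R")
proof -
  have "(\<forall>i j. eis_cong sqrt_minus_3 (g $ i $ j) (mat 1 $ i $ j)) \<longleftrightarrow> ?R"
    unfolding eis_cong_def diff_eq_eq by (simp only: Bex_def choice_iff) (auto simp: add.commute)
  moreover have "g $ i $ j \<in> Eisenstein_ints" if "?R" for i j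
  proof -
    have "mat 1 $ i $ j \<in> Eisenstein_ints"
      by (simp add: mat_def)
    then show ?thesis
      using that by force
  qed
  ultimately show ?thesis
    by (auto simp: Gamma_sqrt_minus_3_def Gamma_1_def)
qed

lemma Gamma_sqrt_minus_3I:
  assumes "g \<in> SU21" "\<And>i j. A i j \<in> Eisenstein_ints"
    "\<And>i j. g $ i $ j = mat 1 $ i $ j + sqrt_minus_3 * A i j"
  shows "g \<in> Gamma_sqrt_minus_3"
  unfolding Gamma_sqrt_minus_3_iff using assms by (intro conjI exI[of _ A]) auto

lemma Upsilon_iff:
  "g \<in> Upsilon \<longleftrightarrow> g \<in> Gamma_sqrt_minus_3 \<and> (\<exists>a\<in>Eisenstein_ints. g $ 1 $ 1 = 1 + 3 * a)"
  by (auto simp: Upsilon_def eis_cong_def diff_eq_eq add.commute)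

lemma subgroup_SU21I:
  assumes "S \<subseteq> SU21" "mat 1 \<in> S" "\<And>g h. g \<in> S \<Longrightarrow> h \<in> S \<Longrightarrow> g ** h \<in> S"
    "\<And>g. g \<in> S \<Longrightarrow> SU21_inverse g \<in> S"
  shows "subgroup S SU21_group"
proof (rule group.subgroupI[OF group_SU21])
  show "inv\<^bsub>SU21_group\<^esub> g \<in> S" if "g \<in> S" for g
    using that assms(1,4) inv_SU21_group[of g] by auto
qed (use assms in \<open>auto simp: SU21_group_def\<close>)

lemma Gamma_sqrt_minus_3_one: "mat 1 \<in> Gamma_sqrt_minus_3"
  unfolding Gamma_sqrt_minus_3_iff using SU21_one by (auto intro!: exI[of _ "\<lambda>_ _. 0"])

lemma Gamma_sqrt_minus_3_mult:
  assumes "g \<in> Gamma_sqrt_minus_3" "h \<in> Gamma_sqrt_minus_3"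
  shows "g ** h \<in> Gamma_sqrt_minus_3"
proof -
  obtain A where A: "\<And>i j. A i j \<in> Eisenstein_ints" "\<And>i j. g $ i $ j = mat 1 $ i $ j + sqrt_minus_3 * A i j"
    using assms(1) unfolding Gamma_sqrt_minus_3_iff by blast
  obtain B where B: "\<And>i j. B i j \<in> Eisenstein_ints" "\<And>i j. h $ i $ j = mat 1 $ i $ j + sqrt_minus_3 * B i j"
    using assms(2) unfolding Gamma_sqrt_minus_3_iff by blast
  have "(g ** h) $ i $ j = mat 1 $ i $ j + sqrt_minus_3 *
      (A i j + B i j + sqrt_minus_3 * (A i 1 * B 1 j + A i 2 * B 2 j + A i 3 * B 3 j))" for i j
    using exhaust_3[of i] exhaust_3[of j]
    by (elim disjE; simp add: matrix_matrix_mult_def sum_3 A(2) B(2) mat_def algebra_simps)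
  moreover have "A i j + B i j + sqrt_minus_3 * (A i 1 * B 1 j + A i 2 * B 2 j + A i 3 * B 3 j)
      \<in> Eisenstein_ints" for i j
    by (intro Eisenstein_ints_add Eisenstein_ints_mult A B Eisenstein_ints_sqrt_minus_3)
  moreover have "g ** h \<in> SU21"
    using assms SU21_mult by (simp add: Gamma_sqrt_minus_3_iff)
  ultimately show ?thesis
    by (intro Gamma_sqrt_minus_3I)
qed

lemma Gamma_sqrt_minus_3_inverse:
  assumes "g \<in> Gamma_sqrt_minus_3" shows "SU21_inverse g \<in> Gamma_sqrt_minus_3"
proof -
  obtain A where A: "\<And>i j. A i j \<in> Eisenstein_ints" "\<And>i j. g $ i $ j = mat 1 $ i $ j + sqrt_minus_3 * A i j"
    using assms unfolding Gamma_sqrt_minus_3_iff by blast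
  \<comment> \<open>\<open>J_form\<close> on both sides reverses the indices; the conjugate of
    \<open>sqrt_minus_3\<close> contributes the sign below.\<close>
  define r :: "3 \<Rightarrow> 3" where "r i = (if i = 1 then 3 else if i = 3 then 1 else 2)" for i
  have "SU21_inverse g $ i $ j = mat 1 $ i $ j + sqrt_minus_3 * (- cnj (A (r j) (r i)))" for i j
    using exhaust_3[of i] exhaust_3[of j]
    by (elim disjE; simp add: SU21_inverse_nth A(2) mat_def r_def cnj_sqrt_minus_3)
  moreover have "- cnj (A (r j) (r i)) \<in> Eisenstein_ints" for i j
    by (intro Eisenstein_ints_uminus Eisenstein_ints_cnj A)
  moreover have "SU21_inverse g \<in> SU21"
    using assms SU21_inverse_closed by (simp add: Gamma_sqrt_minus_3_iff)
  ultimately show ?thesis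
    by (intro Gamma_sqrt_minus_3I)
qed

lemma subgroup_Gamma_sqrt_minus_3: "subgroup Gamma_sqrt_minus_3 SU21_group"
  by (rule subgroup_SU21I)
    (auto simp: Gamma_sqrt_minus_3_one Gamma_sqrt_minus_3_mult Gamma_sqrt_minus_3_inverse
      Gamma_sqrt_minus_3_iff[THEN iffD1])

text \<open>Off-diagonal entries are multiples of \<open>sqrt_minus_3\<close>, whose square is -3,
  so the upper left entry is multiplicative modulo 3.\<close>

lemma Gamma_sqrt_minus_3_mult_1_1:
  assumes "g \<in> Gamma_sqrt_minus_3" "h \<in> Gamma_sqrt_minus_3"
  obtains c where "c \<in> Eisenstein_ints" "(g ** h) $ 1 $ 1 = g $ 1 $ 1 * h $ 1 $ 1 + 3 * c"
proof -
  obtain A where A: "\<And>i j. A i j \<in> Eisenstein_ints" "\<And>i j. g $ i $ j = mat 1 $ i $ j + sqrt_minus_3 * A i j"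
    using assms(1) unfolding Gamma_sqrt_minus_3_iff by blast
  obtain B where B: "\<And>i j. B i j \<in> Eisenstein_ints" "\<And>i j. h $ i $ j = mat 1 $ i $ j + sqrt_minus_3 * B i j"
    using assms(2) unfolding Gamma_sqrt_minus_3_iff by blast
  have sq: "sqrt_minus_3 * x * (sqrt_minus_3 * y) = 3 * - (x * y)" for x y
    using sqrt_minus_3_squared by (simp add: algebra_simps) (simp flip: mult.assoc)
  have "g $ 1 $ 2 * h $ 2 $ 1 = 3 * - (A 1 2 * B 2 1)" "g $ 1 $ 3 * h $ 3 $ 1 = 3 * - (A 1 3 * B 3 1)"
    by (simp_all add: A(2) B(2) mat_def sq)
  then have "(g ** h) $ 1 $ 1 = g $ 1 $ 1 * h $ 1 $ 1 + 3 * (- (A 1 2 * B 2 1) + - (A 1 3 * B 3 1))"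
    by (simp add: matrix_matrix_mult_def sum_3)
  moreover have "- (A 1 2 * B 2 1) + - (A 1 3 * B 3 1) \<in> Eisenstein_ints"
    by (intro Eisenstein_ints_add Eisenstein_ints_mult Eisenstein_ints_uminus A B)
  ultimately show ?thesis
    using that by blast
qed

lemma subgroup_Upsilon: "subgroup Upsilon SU21_group"
proof (rule subgroup_SU21I)
  show "Upsilon \<subseteq> SU21"
    by (auto simp: Upsilon_iff Gamma_sqrt_minus_3_iff)
  show "mat 1 \<in> Upsilon"
    unfolding Upsilon_iff by (intro conjI Gamma_sqrt_minus_3_one bexI[of _ 0]) (simp_all add: mat_def)
  fix g assume g: "g \<in> Upsilon"
  then obtain a where a: "a \<in> Eisenstein_ints" "g $ 1 $ 1 = 1 + 3 * a"
    by (auto simp: Upsilon_iff)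
  {
    fix h assume h: "h \<in> Upsilon"
    then obtain b where b: "b \<in> Eisenstein_ints" "h $ 1 $ 1 = 1 + 3 * b"
      by (auto simp: Upsilon_iff)
    obtain c where c: "c \<in> Eisenstein_ints" "(g ** h) $ 1 $ 1 = g $ 1 $ 1 * h $ 1 $ 1 + 3 * c"
      using g h by (auto simp: Upsilon_iff elim: Gamma_sqrt_minus_3_mult_1_1)
    \<comment> \<open>The numeral 3 is written \<open>1 + 1 + 1\<close> so that the closure rules
      for \<open>Eisenstein_ints\<close> apply.\<close>
    have "(g ** h) $ 1 $ 1 = 1 + 3 * (a + b + (1 + 1 + 1) * (a * b) + c)"
      by (simp add: a b c algebra_simps)
    moreover have "a + b + (1 + 1 + 1) * (a * b) + c \<in> Eisenstein_ints"
      by (intro Eisenstein_ints_add Eisenstein_ints_mult a b c Eisenstein_ints_1)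
    moreover have "g ** h \<in> Gamma_sqrt_minus_3"
      using g h Gamma_sqrt_minus_3_mult by (simp add: Upsilon_iff)
    ultimately show "g ** h \<in> Upsilon"
      unfolding Upsilon_iff by blast
  }
  let ?h = "SU21_inverse g"
  have gG: "g \<in> Gamma_sqrt_minus_3" and hG: "?h \<in> Gamma_sqrt_minus_3"
    using g Gamma_sqrt_minus_3_inverse by (auto simp: Upsilon_iff)
  \<comment> \<open>The explicit inverse has the conjugate of entry (3,3) in this corner, which the
    definition of \<open>Upsilon\<close> does not mention; the congruence is instead solved from
    \<open>g ** ?h = mat 1\<close>.\<close>
  obtain c where c: "c \<in> Eisenstein_ints" "(g ** ?h) $ 1 $ 1 = g $ 1 $ 1 * ?h $ 1 $ 1 + 3 * c"
    using Gamma_sqrt_minus_3_mult_1_1[OF gG hG] .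
  have "g ** ?h = mat 1"
    using gG by (intro SU21_right_inverse) (simp add: Gamma_sqrt_minus_3_iff)
  then have "?h $ 1 $ 1 = 1 + 3 * - (a * ?h $ 1 $ 1 + c)"
    using c(2) by (simp add: a(2) mat_def algebra_simps)
  moreover have "?h $ 1 $ 1 \<in> Eisenstein_ints"
    using hG by (simp add: Gamma_sqrt_minus_3_def Gamma_1_def)
  then have "- (a * ?h $ 1 $ 1 + c) \<in> Eisenstein_ints"
    by (intro Eisenstein_ints_add Eisenstein_ints_mult Eisenstein_ints_uminus a c)
  ultimately show "?h \<in> Upsilon"
    using hG unfolding Upsilon_iff by blast
qed

lemma weyl_unip_weyl:
  "weyl ** unip v c ** weyl = vector [vector [1, 0, 0], vector [v, 1, 0], vector [c, - cnj v, 1]]"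
  by (simp add: weyl_def unip_def mat3_simps)

lemma unip_mem_Upsilon:
  assumes "a \<in> Eisenstein_ints" "b \<in> Eisenstein_ints" "v = sqrt_minus_3 * a" "c = sqrt_minus_3 * b"
    and vc: "c + cnj c = - (v * cnj v)"
  shows "unip v c \<in> Upsilon" "weyl ** unip v c ** weyl \<in> Upsilon"
proof -
  have v: "- cnj v = sqrt_minus_3 * cnj a"
    by (simp add: assms cnj_sqrt_minus_3)
  let ?A = "\<lambda>i j :: 3. if i = 1 \<and> j = 2 then cnj a else if i = 1 \<and> j = 3 then b
    else if i = 2 \<and> j = 3 then a else 0"
  have "unip v c \<in> SU21" "weyl ** unip v c ** weyl \<in> SU21"
    using unip_SU21[OF vc] by (simp_all add: SU21_mult weyl_SU21)
  moreover have "?A i j \<in> Eisenstein_ints" for i j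
    using assms(1,2) by simp
  moreover have "unip v c $ i $ j = mat 1 $ i $ j + sqrt_minus_3 * ?A i j" for i j
    using exhaust_3[of i] exhaust_3[of j]
    by (elim disjE; simp add: unip_def mat_def v; simp add: assms(3,4))
  \<comment> \<open>Conjugation by \<open>weyl\<close> reverses rows and columns; in the index type,
    subtraction from 4 swaps 1 and 3 and fixes 2.\<close>
  moreover have "(weyl ** unip v c ** weyl) $ i $ j = mat 1 $ i $ j + sqrt_minus_3 * ?A (4 - i) (4 - j)" for i j
    using exhaust_3[of i] exhaust_3[of j] unfolding weyl_unip_weyl
    by (elim disjE; simp add: mat_def v; simp add: assms(3,4))
  ultimately have "unip v c \<in> Gamma_sqrt_minus_3" "weyl ** unip v c ** weyl \<in> Gamma_sqrt_minus_3"
    by (blast intro: Gamma_sqrt_minus_3I[of _ ?A] Gamma_sqrt_minus_3I[of _ "\<lambda>i j. ?A (4 - i) (4 - j)"])+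
  then show "unip v c \<in> Upsilon" "weyl ** unip v c ** weyl \<in> Upsilon"
    unfolding Upsilon_iff weyl_unip_weyl by (auto simp: unip_def intro!: bexI[of _ 0])
qed

lemma unip_lifts_mem_Upsilon:
  "unip 0 (- sqrt_minus_3) \<in> Upsilon" "weyl ** unip 0 (- sqrt_minus_3) ** weyl \<in> Upsilon"
  "unip sqrt_minus_3 (sqrt_minus_3 * zeta3) \<in> Upsilon"
  "weyl ** unip sqrt_minus_3 (sqrt_minus_3 * zeta3) ** weyl \<in> Upsilon"
  "unip (sqrt_minus_3 * zeta3) (sqrt_minus_3 * zeta3) \<in> Upsilon"
  "weyl ** unip (sqrt_minus_3 * zeta3) (sqrt_minus_3 * zeta3) ** weyl \<in> Upsilon"
  using unip_mem_Upsilon[of 0 "- 1" 0 "- sqrt_minus_3"]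
    unip_mem_Upsilon[of 1 zeta3 sqrt_minus_3 "sqrt_minus_3 * zeta3"]
    unip_mem_Upsilon[of zeta3 zeta3 "sqrt_minus_3 * zeta3" "sqrt_minus_3 * zeta3"] unip_params
  by auto

subsection \<open>Weight denominators and multiplier systems\<close>

lemma (in group_hom) subgroup_preimage:
  assumes "subgroup I H" shows "subgroup {x \<in> carrier G. h x \<in> I} G"
proof (rule G.subgroupI)
  show "{x \<in> carrier G. h x \<in> I} \<noteq> {}"
    using subgroup.one_closed[OF assms] by force
qed (use assms in \<open>auto intro: subgroup.m_closed subgroup.m_inv_closed\<close>)

lemma group_hom_fst_lift: "group_hom lift_group SU21_group fst"
proof -
  have "fst \<in> hom lift_group SU21_group"
    by (auto simp: hom_def SU21_group_def lift_group_carrier)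
  then show ?thesis
    by (simp add: group_hom_def group_hom_axioms_def group_lift_group group_SU21)
qed

lemma group_hom_cover_to_lift: "group_hom SU21_cover lift_group cover_to_lift"
  by (simp add: group_hom_def group_hom_axioms_def group_lift_group group_cover cover_to_lift_hom)

lemma group_hom_cover_proj: "group_hom SU21_cover SU21_group cover_proj"
  by (simp add: group_hom_def group_hom_axioms_def group_SU21 group_cover cover_proj_hom)

lemma inv_weyl_lift: "inv\<^bsub>lift_group\<^esub> weyl_lift = weyl_lift"
  by (rule group.inv_equality[OF group_lift_group weyl_lift_squared weyl_lift_carrier weyl_lift_carrier])

lemma deck_1_mem_derived_lifts:
  assumes "subgroup \<Gamma> SU21_group" "Upsilon \<subseteq> \<Gamma>"
  shows "deck 1 \<in> derived lift_group {x \<in> carrier lift_group. fst x \<in> \<Gamma>}"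
proof (rule deck_1_mem_derived)
  show "subgroup {x \<in> carrier lift_group. fst x \<in> \<Gamma>} lift_group"
    by (rule group_hom.subgroup_preimage[OF group_hom_fst_lift assms(1)])
qed (use assms(2) unip_lifts_mem_Upsilon unip_lifts_carrier weyl_lift_carrier in
    \<open>auto intro!: lift_group_mult_closed simp: unip_lift_def weyl_lift_def\<close>)

text \<open>The explicit path of \<open>unip_path\<close> realizes the first lift, and
  \<open>conj_path\<close> realizes its conjugate, so the relation among branches can be pulled back
  to the path model.\<close>

lemma unip_lift_covered:
  assumes vc: "c + cnj c = - (v * cnj v)"
    and mem: "unip v c \<in> \<Gamma>" "weyl ** unip v c ** weyl \<in> \<Gamma>"
  shows "unip_lift v c \<in> cover_to_lift ` cover_preimage \<Gamma>"
    "weyl_conj (unip_lift v c) \<in> cover_to_lift ` cover_preimage \<Gamma>"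
proof -
  obtain p where p: "based_path p" "branch_along p (\<lambda>_. 0)" "p 1 = unip v c"
    using unip_path[OF vc] .
  have "path_class p \<in> cover_preimage \<Gamma>"
    using p mem by (auto simp: cover_preimage_def cover_carrier cover_proj_path_class)
  moreover have "cover_to_lift (path_class p) = unip_lift v c"
    using p by (simp add: cover_to_lift_path_class unip_lift_def)
  ultimately show "unip_lift v c \<in> cover_to_lift ` cover_preimage \<Gamma>"
    by (metis image_eqI)
  obtain q where q: "based_path q" "cover_to_lift (path_class q) = weyl_conj (unip_lift v c)"
    using conj_path[OF weyl_lift_carrier p(1,2)]
    unfolding p(3) inv_weyl_lift by (auto simp: unip_lift_def)
  then have "cover_proj (path_class q) = weyl ** unip v c ** weyl"
    by (simp add: weyl_lift_def unip_lift_def flip: fst_cover_to_lift)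
  then have "path_class q \<in> cover_preimage \<Gamma>"
    using q mem by (auto simp: cover_preimage_def cover_carrier)
  with q(2) show "weyl_conj (unip_lift v c) \<in> cover_to_lift ` cover_preimage \<Gamma>"
    by (metis image_eqI)
qed

text \<open>Some product of commutators \<open>d\<close> maps to \<open>deck 1\<close> and lies in
  the kernel, so it is the \<open>k\<close>-th power of \<open>z\<close>. If \<open>z\<close> maps
  to \<open>deck m\<close>, then \<open>m * k = 1\<close>, which forces \<open>z\<close> to be
  \<open>d\<close> or its inverse.\<close>

lemma kernel_generator_mem_derived:
  assumes \<Gamma>: "subgroup \<Gamma> SU21_group" "Upsilon \<subseteq> \<Gamma>" and z: "generates_cover_kernel z"
  shows "z \<in> derived SU21_cover (cover_preimage \<Gamma>)"
proof -
  interpret P: group_hom SU21_cover lift_group cover_to_lift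
    by (rule group_hom_cover_to_lift)
  let ?K = "cover_preimage \<Gamma>" and ?D = "derived SU21_cover (cover_preimage \<Gamma>)"
  have K: "subgroup ?K SU21_cover"
    unfolding cover_preimage_def by (rule group_hom.subgroup_preimage[OF group_hom_cover_proj \<Gamma>(1)])
  have zK: "z \<in> carrier SU21_cover" "cover_proj z = mat 1"
    using z by (auto simp: generates_cover_kernel_def kernel_def SU21_group_def)
  have "deck 1 \<in> derived lift_group (cover_to_lift ` ?K)"
  proof (rule deck_1_mem_derived)
    show "subgroup (cover_to_lift ` ?K) lift_group"
      by (rule P.subgroup_img_is_subgroup[OF K])
  qed (use \<Gamma>(2) unip_lifts_mem_Upsilon in \<open>auto intro!: unip_lift_covered unip_params\<close>)
  also have "\<dots> = cover_to_lift ` ?D"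
    by (rule P.derived_img[OF subgroup.subset[OF K]])
  finally obtain d where d: "d \<in> ?D" "cover_to_lift d = deck 1"
    by auto
  have dc: "d \<in> carrier SU21_cover"
    using d(1) P.G.derived_in_carrier[OF subgroup.subset[OF K]] by blast
  moreover have "cover_proj d = mat 1"
    using arg_cong[OF d(2), of fst] by (simp add: deck_def)
  ultimately have "d \<in> generate SU21_cover {z}"
    using z by (simp add: generates_cover_kernel_def kernel_def SU21_group_def)
  then obtain k :: int where k: "d = z [^]\<^bsub>SU21_cover\<^esub> k"
    using P.G.generate_pow[OF zK(1)] by auto
  obtain m where m: "cover_to_lift z = deck m"
    using lift_over_one_is_deck[of "snd (cover_to_lift z)"] P.hom_closed[OF zK(1)] zK(2)
    by (metis fst_cover_to_lift prod.collapse)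
  have "deck (m * k) = deck 1"
    using P.hom_int_pow[OF zK(1), of k] d(2) by (simp add: k m deck_int_pow)
  then have "k = 1 \<or> k = - 1"
    using zmult_eq_1_iff by (auto simp: deck_inject)
  then have "z = d \<or> z = inv\<^bsub>SU21_cover\<^esub> d"
    using zK(1) by (auto simp: k P.G.int_pow_neg)
  then show ?thesis
    using d(1) subgroup.m_inv_closed[OF P.G.derived_is_subgroup[OF subgroup.subset[OF K]]] by auto
qed

lemma weight_denominator_eq_1:
  assumes \<Gamma>: "subgroup \<Gamma> SU21_group" "Upsilon \<subseteq> \<Gamma>" and z: "generates_cover_kernel z"
  shows "weight_denominator z \<Gamma> = 1"
proof -
  let ?G = "SU21_cover\<lparr>carrier := cover_preimage \<Gamma>\<rparr>"
  have K: "subgroup (cover_preimage \<Gamma>) SU21_cover"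
    unfolding cover_preimage_def by (rule group_hom.subgroup_preimage[OF group_hom_cover_proj \<Gamma>(1)])
  interpret G: group ?G
    by (rule group.subgroup_imp_group[OF group_cover K])
  let ?D = "derived ?G (carrier ?G)"
  interpret D: normal ?D ?G
    by (rule G.derived_self_is_normal)
  have "z \<in> ?D"
    using kernel_generator_mem_derived[OF assms] group.derived_consistent[OF group_cover _ K] by simp
  then have "?D #>\<^bsub>?G\<^esub> z = \<one>\<^bsub>?G Mod ?D\<^esub>"
    using G.coset_join2[OF _ D.subgroup_axioms] D.subset by (auto simp: FactGroup_def)
  then show ?thesis
    unfolding weight_denominator_def Let_def
    using group.ord_id[OF D.factorgroup_is_group] by simp
qed

section \<open>Integrality of the weight\<close>

lemma multiplier_system_integral_weight:
  assumes \<Gamma>: "subgroup \<Gamma> SU21_group" "Upsilon \<subseteq> \<Gamma>" and l: "multiplier_system \<Gamma> a b l"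
  shows "(of_int a / of_nat b :: rat) \<in> \<int>"
proof -
  interpret group lift_group
    by (rule group_lift_group)
  let ?K = "{x \<in> carrier lift_group. fst x \<in> \<Gamma>}"
  have K: "subgroup ?K lift_group"
    by (rule group_hom.subgroup_preimage[OF group_hom_fst_lift \<Gamma>(1)])
  have b: "b > 0"
    and nz: "\<And>g \<tau>. g \<in> \<Gamma> \<Longrightarrow> \<tau> \<in> siegel_domain \<Longrightarrow> l g \<tau> \<noteq> 0"
    and lmult: "\<And>g h \<tau>. g \<in> \<Gamma> \<Longrightarrow> h \<in> \<Gamma> \<Longrightarrow> \<tau> \<in> siegel_domain \<Longrightarrow>
        l (g ** h) \<tau> = l g (siegel_act h \<tau>) * l h \<tau>"
    and cont: "\<And>g. g \<in> \<Gamma> \<Longrightarrow> continuous_on siegel_domain (l g)"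
    using l unfolding multiplier_system_def by auto
  obtain u where u: "\<And>g \<tau>. g \<in> \<Gamma> \<Longrightarrow> \<tau> \<in> siegel_domain \<Longrightarrow> l g \<tau> ^ b = u g * j_factor g \<tau> powi a"
    using l unfolding multiplier_system_def by blast
  \<comment> \<open>Dividing \<open>l\<close> by the branch of \<open>j\<close> to the power \<open>a / b\<close> leaves a function whose \<open>b\<close>-th power is
    constant; this gives a character \<open>\<phi>\<close> of the lift of \<open>\<Gamma>\<close>, which is trivial on commutators.\<close>
  define r where "r = (of_int a / of_nat b :: complex)"
  have br: "of_nat b * r = of_int a"
    using b by (simp add: r_def)
  define \<phi> where "\<phi> x \<tau> = l (fst x) \<tau> * exp (- r * snd x \<tau>)" for x \<tau>
  have const: "\<phi> x \<sigma> = \<phi> x \<tau>"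
    if x: "x \<in> ?K" and "\<sigma> \<in> siegel_domain" "\<tau> \<in> siegel_domain" for x \<sigma> \<tau>
  proof -
    obtain g L where eq: "x = (g, L)"
      by (metis surj_pair)
    have gL: "g \<in> \<Gamma>" "continuous_on siegel_domain L"
      "\<And>\<tau>. \<tau> \<in> siegel_domain \<Longrightarrow> exp (L \<tau>) = j_factor g \<tau>"
      using x by (auto simp: eq lift_group_carrier)
    have "\<phi> x \<tau> ^ b = u g" if "\<tau> \<in> siegel_domain" for \<tau>
    proof -
      have "exp (- r * L \<tau>) ^ b = exp (of_nat b * (- r * L \<tau>))"
        by (rule exp_of_nat_mult[symmetric])
      also have "of_nat b * (- r * L \<tau>) = - (of_int a * L \<tau>)"
        using br by (simp flip: mult.assoc)
      finally have "\<phi> x \<tau> ^ b = u g * exp (L \<tau>) powi a * exp (- (of_int a * L \<tau>))"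
        using u[OF gL(1) that] gL(3)[OF that] by (simp add: \<phi>_def eq power_mult_distrib)
      also have "\<dots> = u g * (exp (of_int a * L \<tau>) * exp (- (of_int a * L \<tau>)))"
        by (simp add: exp_power_int)
      finally show ?thesis
        by (simp flip: exp_add)
    qed
    then have "\<phi> x ` siegel_domain \<subseteq> {w. w ^ b = u g}"
      by auto
    \<comment> \<open>The equation has finitely many roots, and a continuous function with finite
      range on a connected set is constant.\<close>
    then have "finite (\<phi> x ` siegel_domain)"
      using finite_nth_roots[OF b] finite_subset by blast
    moreover have "continuous_on siegel_domain (\<phi> x)"
      unfolding \<phi>_def eq using gL cont by (auto intro!: continuous_intros)
    ultimately have "\<phi> x constant_on siegel_domain"
      using connected_siegel_domain continuous_finite_range_constant_eq by blast
    then show ?thesis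
      using that(2,3) unfolding constant_on_def by metis
  qed
  have SU: "fst x \<in> SU21" if "x \<in> ?K" for x
    using that by (cases x) (simp add: lift_group_carrier)
  note \<tau> = tau0_mem
  have mult: "\<phi> (x \<otimes>\<^bsub>lift_group\<^esub> y) tau0 = \<phi> x tau0 * \<phi> y tau0" if "x \<in> ?K" "y \<in> ?K" for x y
  proof -
    have "\<phi> (x \<otimes>\<^bsub>lift_group\<^esub> y) tau0 = \<phi> x (siegel_act (fst y) tau0) * \<phi> y tau0"
      using that lmult[OF _ _ \<tau>, of "fst x" "fst y"]
      by (simp add: \<phi>_def snd_lift_group_mult[OF \<tau>] exp_add[symmetric] algebra_simps)
    then show ?thesis
      using const[OF that(1) siegel_act_closed[OF SU[OF that(2)] \<tau>] \<tau>] by simp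
  qed
  have nz\<phi>: "\<phi> x tau0 \<noteq> 0" if "x \<in> ?K" for x
    using that nz[OF _ \<tau>] by (simp add: \<phi>_def)
  have oneK: "\<one>\<^bsub>lift_group\<^esub> \<in> ?K"
    by (rule subgroup.one_closed[OF K])
  have one: "\<phi> \<one>\<^bsub>lift_group\<^esub> tau0 = 1"
    using mult[OF oneK oneK] nz\<phi>[OF oneK] by simp
  have inv: "\<phi> (inv\<^bsub>lift_group\<^esub> x) tau0 = inverse (\<phi> x tau0)" if "x \<in> ?K" for x
    using mult[OF that subgroup.m_inv_closed[OF K that]] one nz\<phi>[OF that] that
    by (simp add: inverse_unique)
  \<comment> \<open>The kernel of the character; it contains all commutators because the values
    commute.\<close>
  let ?N = "{x \<in> ?K. \<phi> x tau0 = 1}"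
  have N: "subgroup ?N lift_group"
  proof (rule subgroupI)
    show "?N \<noteq> {}"
      using oneK one by blast
    show "inv\<^bsub>lift_group\<^esub> x \<in> ?N" if "x \<in> ?N" for x
      using that inv[of x] subgroup.m_inv_closed[OF K, of x] by auto
    show "x \<otimes>\<^bsub>lift_group\<^esub> y \<in> ?N" if "x \<in> ?N" "y \<in> ?N" for x y
      using that mult[of x y] subgroup.m_closed[OF K, of x y] by auto
  qed auto
  have "derived_set lift_group ?K \<subseteq> ?N"
  proof (rule subsetI)
    fix w assume "w \<in> derived_set lift_group ?K"
    then obtain x y where xy: "x \<in> ?K" "y \<in> ?K"
      and w: "w = x \<otimes>\<^bsub>lift_group\<^esub> y \<otimes>\<^bsub>lift_group\<^esub> inv\<^bsub>lift_group\<^esub> x \<otimes>\<^bsub>lift_group\<^esub> inv\<^bsub>lift_group\<^esub> y"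
      by blast
    note closed = subgroup.m_closed[OF K] subgroup.m_inv_closed[OF K]
    have "\<phi> w tau0 = \<phi> x tau0 * \<phi> y tau0 * inverse (\<phi> x tau0) * inverse (\<phi> y tau0)"
      unfolding w by (simp only: mult inv closed xy)
    then have "\<phi> w tau0 = 1"
      using nz\<phi>[OF xy(1)] nz\<phi>[OF xy(2)] by (simp add: field_simps)
    moreover have "w \<in> ?K"
      unfolding w by (intro closed xy)
    ultimately show "w \<in> ?N"
      by blast
  qed
  then have "derived lift_group ?K \<subseteq> ?N"
    unfolding derived_def by (rule generate_subgroup_incl[OF _ N])
  then have "\<phi> (deck 1) tau0 = 1"
    using deck_1_mem_derived_lifts[OF \<Gamma>] by blast
  \<comment> \<open>\<open>deck 1\<close> lies over the identity matrix, where \<open>l\<close> is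
    1, so only the exponential of \<open>- r\<close> times 2 pi i remains.\<close>
  moreover have "l (mat 1) tau0 = 1"
    using one by (simp add: \<phi>_def lift_group_one)
  ultimately have e: "exp (- r * (2 * of_real pi * \<i>)) = 1"
    by (simp add: \<phi>_def deck_def \<tau>)
  define q where "q = real_of_int a / real b"
  define x where "x = - 2 * pi * q"
  have "of_real x * \<i> = - r * (2 * of_real pi * \<i>)"
    by (simp add: x_def q_def r_def)
  with e have "exp (of_real x * \<i>) = 1"
    by (simp only:)
  then obtain n :: int where n: "x = of_int (2 * n) * pi"
    unfolding exp_eq_1 by auto
  have "q = - (x / (2 * pi))"
    by (simp add: x_def)
  then have "real_of_int a / real b = of_int (- n)"
    by (simp add: q_def n)
  then have "real_of_int a = real_of_int (- n * int b)"
    using b by (simp add: field_simps)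
  then have "a = - n * int b"
    by linarith
  then have "(of_int a / of_nat b :: rat) = of_int (- n)"
    using b by simp
  then show ?thesis
    by (metis Ints_of_int)
qed

theorem theorem5:
  shows "(\<forall>z. generates_cover_kernel z \<longrightarrow>
            weight_denominator z Upsilon = 1 \<and>
            weight_denominator z Gamma_sqrt_minus_3 = 1) \<and>
         (\<forall>a b l. multiplier_system Gamma_sqrt_minus_3 a b l \<or> multiplier_system Upsilon a b l \<longrightarrow>
            (of_int a / of_nat b :: rat) \<in> \<int>)"
proof -
  have "Upsilon \<subseteq> Gamma_sqrt_minus_3"
    by (auto simp: Upsilon_def)
  then show ?thesis
    using weight_denominator_eq_1 multiplier_system_integral_weight
      subgroup_Upsilon subgroup_Gamma_sqrt_minus_3 by blast
qed

end
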